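(* Let $p\in(1,\infty)$, $\delta\ge 0$, and let $(\mu_t)_{t\ge0}$ be the marginal laws of an $\mathbb{R}^d$-valued Lévy process starting in $0$ with $\int_{\mathbb{R}^d}|x|^p\,\mu_1(dx)<\infty$. Let $S(t)$, $\mathscr{S}^n(t)$ (for $t\ge 0$, $n\in\mathbb{N}$) be the operators built from Wasserstein balls of radius $\delta t$ around $\mu_t$ as defined in the context. Then $\mathscr{S}^n(t)$ is well-defined on $C_0(\mathbb{R}^d)$ for all $t\ge 0$ and $n\in\mathbb{N}$, the limit $\mathscr{S}(t)f(x):=\lim_{n\to\infty}\mathscr{S}^n(t)f(x)$ exists for all $t\ge0$, $f\in C_0(\mathbb{R}^d)$, $x\in\mathbb{R}^d$, and the family $(\mathscr{S}(t))_{t\ge 0}$ is a sublinear semigroup on $C_0(\mathbb{R}^d)$. More precisely, for every $s,t\ge 0$ and $x\in\mathbb{R}^d$: (i) $\mathscr{S}(t)$ maps $C_0(\mathbb{R}^d)$ to itself and $\mathscr{S}(t)\circ\mathscr{S}(s)=\mathscr{S}(t+s)$; (ii) the map $C_0(\mathbb{R}^d)\to\mathbb{R}$, $f\mapsto \mathscr{S}(t)f(x)$, is sublinear, increasing (i.e. $f\le g$ implies $\mathscr{S}(t)f(x)\le\mathscr{S}(t)g(x)$), and maps zero to zero; and $\mathscr{S}(t)$ is contractive, i.e. $\|\mathscr{S}(t)f-\mathscr{S}(t)g\|_\infty\le\|f-g\|_\infty$ for all $f,g\in C_0(\mathbb{R}^d)$.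
   Context: $|\cdot|$ is the Euclidean norm. $\mathcal{P}_p(\mathbb{R}^d)$ is the set of Borel probability measures on $\mathbb{R}^d$ with finite $p$-th moment, and for $\mu,\nu\in\mathcal{P}_p(\mathbb{R}^d)$, $\mathcal{W}_p(\mu,\nu)=\inf_\gamma\big(\int|y-x|^p\,\gamma(dx,dy)\big)^{1/p}$, the infimum being over all Borel probability measures $\gamma$ on $\mathbb{R}^d\times\mathbb{R}^d$ with first marginal $\mu$ and second marginal $\nu$. $C_0(\mathbb{R}^d)$ is the space of real-valued continuous functions on $\mathbb{R}^d$ vanishing at infinity, with the supremum norm $\|\cdot\|_\infty$. For $t\ge0$, $f\in C_0(\mathbb{R}^d)$ and $x\in\mathbb{R}^d$, set $$S(t)f(x):=\sup\Big\{\int_{\mathbb{R}^d}f(x+y)\,\nu(dy):\nu\in\mathcal{P}_p(\mathbb{R}^d),\ \mathcal{W}_p(\mu_t,\nu)\le\delta t\Big\}.$$ For $n\in\mathbb{N}$ let $\mathbb{T}_n:=2^{-n}\mathbb{N}_0$. For $t\ge0$ let $t_n=k2^{-n}$ (with $k=\lfloor 2^n t\rfloor$) be the closest element of $\mathbb{T}_n$ prior to $t$, and set $$\mathscr{S}^n(t):=\underbrace{S(2^{-n})\circ\cdots\circ S(2^{-n})}_{k\text{ times}}\circ S(t-t_n).$$ "Well-defined" means in particular that the operators $S(\cdot)$ can be composed on $C_0(\mathbb{R}^d)$. "Sublinear" means subadditive and positively homogeneous. *)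

theory Defs
  imports "HOL-Probability.Probability"
begin

section \<open>Continuous functions vanishing at infinity\<close>

definition C0 :: "('a::euclidean_space \<Rightarrow> real) set" where
  "C0 = {f. continuous_on UNIV f \<and> (f \<longlongrightarrow> 0) at_infinity}"

text \<open>Only meaningful for bounded functions, in particular for elements and differences of
  elements of \<^term>\<open>C0\<close>.\<close>

definition sup_norm :: "('a \<Rightarrow> real) \<Rightarrow> real" where
  "sup_norm f = (SUP x. \<bar>f x\<bar>)"

definition sublinear_on_C0 :: "(('a::euclidean_space \<Rightarrow> real) \<Rightarrow> real) \<Rightarrow> bool" where
  "sublinear_on_C0 F \<longleftrightarrow>
     (\<forall>f\<in>C0. \<forall>g\<in>C0. F (\<lambda>x. f x + g x) \<le> F f + F g) \<and>
     (\<forall>c>0. \<forall>f\<in>C0. F (\<lambda>x. c * f x) = c * F f)"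


section \<open>Wasserstein distance\<close>

definition prob_measures_p :: "real \<Rightarrow> 'a::euclidean_space measure set" where
  "prob_measures_p p =
     {\<nu>. prob_space \<nu> \<and> sets \<nu> = sets borel \<and> integrable \<nu> (\<lambda>x. norm x powr p)}"

definition couplings ::
  "'a::euclidean_space measure \<Rightarrow> 'a measure \<Rightarrow> ('a \<times> 'a) measure set" where
  "couplings \<mu> \<nu> =
     {\<gamma>. prob_space \<gamma> \<and> sets \<gamma> = sets borel \<and> distr \<gamma> borel fst = \<mu> \<and> distr \<gamma> borel snd = \<nu>}"

text \<open>Only meaningful for \<^term>\<open>\<mu>\<close> and \<^term>\<open>\<nu>\<close> in \<^term>\<open>prob_measures_p p\<close> (with \<open>p > 0\<close>).  There
  the product measure is a coupling, and the integrand is integrable for every coupling, so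
  that the convention giving the integral of a non-integrable function the value 0 plays no role.\<close>

definition wasserstein ::
  "real \<Rightarrow> 'a::euclidean_space measure \<Rightarrow> 'a measure \<Rightarrow> real" where
  "wasserstein p \<mu> \<nu> =
     (INF \<gamma>\<in>couplings \<mu> \<nu>. (\<integral>z. norm (snd z - fst z) powr p \<partial>\<gamma>) powr (1 / p))"

definition wasserstein_ball ::
  "real \<Rightarrow> 'a::euclidean_space measure \<Rightarrow> real \<Rightarrow> 'a measure set" where
  "wasserstein_ball p \<mu> r = {\<nu> \<in> prob_measures_p p. wasserstein p \<mu> \<nu> \<le> r}"


section \<open>Levy processes\<close>

text \<open>Only the values of \<open>X\<close> at times \<open>t \<ge> 0\<close> matter.  Path regularity is imposed as continuity in
  probability, which holds for every process with independent stationary increments and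
  cadlag paths.\<close>

definition levy_process :: "'w measure \<Rightarrow> (real \<Rightarrow> 'w \<Rightarrow> 'a::euclidean_space) \<Rightarrow> bool" where
  "levy_process M X \<longleftrightarrow>
     prob_space M \<and>
     (\<forall>t\<ge>0. X t \<in> borel_measurable M) \<and>
     (AE w in M. X 0 w = 0) \<and>
     (\<forall>(m::nat) \<tau>. 0 \<le> \<tau> 0 \<and> (\<forall>i<m. \<tau> i < \<tau> (Suc i)) \<longrightarrow>
        prob_space.indep_vars M (\<lambda>_. borel) (\<lambda>i w. X (\<tau> (Suc i)) w - X (\<tau> i) w) {..<m}) \<and>
     (\<forall>s\<ge>0. \<forall>t\<ge>0. distr M borel (\<lambda>w. X (s + t) w - X s w) =
                     distr M borel (\<lambda>w. X t w - X 0 w)) \<and>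
     (\<forall>s\<ge>0. \<forall>\<epsilon>>0. ((\<lambda>t. measure M {w \<in> space M. \<epsilon> < norm (X t w - X s w)}) \<longlongrightarrow> 0)
                      (at s within {0..}))"


section \<open>The operators\<close>

definition S_op ::
  "real \<Rightarrow> real \<Rightarrow> (real \<Rightarrow> 'a::euclidean_space measure) \<Rightarrow> real \<Rightarrow> ('a \<Rightarrow> real) \<Rightarrow> 'a \<Rightarrow> real" where
  "S_op p \<delta> \<mu> t f x = (SUP \<nu>\<in>wasserstein_ball p (\<mu> t) (\<delta> * t). \<integral>y. f (x + y) \<partial>\<nu>)"

definition S_dyadic ::
  "real \<Rightarrow> real \<Rightarrow> (real \<Rightarrow> 'a::euclidean_space measure) \<Rightarrow> nat \<Rightarrow> real \<Rightarrow>
     ('a \<Rightarrow> real) \<Rightarrow> 'a \<Rightarrow> real" where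
  "S_dyadic p \<delta> \<mu> n t f =
     (let k = nat \<lfloor>2 ^ n * t\<rfloor>
      in (S_op p \<delta> \<mu> (1 / 2 ^ n) ^^ k) (S_op p \<delta> \<mu> (t - real k / 2 ^ n) f))"

definition S_lim ::
  "real \<Rightarrow> real \<Rightarrow> (real \<Rightarrow> 'a::euclidean_space measure) \<Rightarrow> real \<Rightarrow> ('a \<Rightarrow> real) \<Rightarrow> 'a \<Rightarrow> real" where
  "S_lim p \<delta> \<mu> t f x = lim (\<lambda>n. S_dyadic p \<delta> \<mu> n t f x)"

end

theory Submission
  imports Defs
begin

text \<open>
  A measure in the Wasserstein ball of radius \<open>\<delta> t\<close> around \<open>\<mu> t\<close> is, up to an arbitrarily small error
  in the integrals, the law of \<open>X + Z\<close> with \<open>X\<close> of law \<open>\<mu> t\<close> and a displacement \<open>Z\<close> of \<open>L\<^sup>p\<close>-norm at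
  most \<open>\<delta> t\<close>.  Adding to it a pair \<open>(X', Z')\<close> for time \<open>s\<close> whose joint law may depend on \<open>X + Z\<close>, but
  whose first component has law \<open>\<mu> s\<close> in any case, gives a law of \<open>X + X'\<close> equal to the convolution
  \<open>\<mu> (t + s)\<close> and, by Minkowski's inequality, a displacement of norm at most \<open>\<delta> (t + s)\<close>.  Hence
  \<open>S(t) \<circ> S(s) \<le> S(t + s)\<close>; since functions in \<open>C\<^sub>0\<close> are uniformly continuous, it suffices that the
  dependence on \<open>X + Z\<close> takes countably many values, so no measurable selection is needed.

  Consequently the dyadic iterates decrease in \<open>n\<close> and converge.  Their limit is squeezed between
  elements of \<open>C\<^sub>0\<close> by sublinearity, so Dini's theorem makes the convergence uniform; this yields the
  semigroup law for dyadic times, and continuity in time extends it to all times.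
\<close>

section \<open>Continuous functions vanishing at infinity\<close>

text \<open>No optimal coupling is required. A coupling whose cost overshoots the radius by e is
  scaled back into the ball; this moves its displacement by at most e in the p-norm, and the
  integrals of a uniformly continuous bounded function hardly change. The inequality S(t) S(s) \<le>
  S(t + s) is the only place where the geometry of the balls enters the limit procedure. Afterwards
  sublinearity, translation invariance and continuity at time 0 suffice, which is why that part is
  carried out for abstract operators. Translation invariance gives every iterate, and hence the
  limit, the modulus of continuity of f itself. The monotone limit is controlled only from above by
  a single step; the matching lower bound comes from -P(-f) \<le> P f, valid for every sublinear P.
  The obstacle in the semigroup law is that the dyadic splitting of t + s is compatible with that of
  s only when t is a grid point.\<close>

lemma C0_continuous: "f \<in> C0 \<Longrightarrow> continuous_on UNIV f"
  by (simp add: C0_def)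

lemma C0_measurable: "f \<in> C0 \<Longrightarrow> f \<in> borel_measurable borel"
  by (intro borel_measurable_continuous_onI C0_continuous)

lemma C0_small_outside:
  assumes "f \<in> C0" "0 < e"
  obtains R where "0 < R" "\<And>x. R \<le> norm x \<Longrightarrow> \<bar>f x\<bar> < e"
proof -
  have "\<forall>\<^sub>F x in at_infinity. dist (f x) 0 < e"
    using assms by (intro tendstoD) (auto simp: C0_def)
  then obtain b where "\<And>x. b \<le> norm x \<Longrightarrow> \<bar>f x\<bar> < e"
    by (auto simp: eventually_at_infinity)
  then show thesis
    by (intro that[of "max b 1"]) auto
qed

lemma C0_iff:
  "f \<in> C0 \<longleftrightarrow> continuous_on UNIV f \<and> (\<forall>e>0. \<exists>R. \<forall>x. R \<le> norm x \<longrightarrow> \<bar>f x\<bar> < e)"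
  by (auto simp: C0_def tendsto_iff eventually_at_infinity)

lemma C0_zero: "(\<lambda>_. 0) \<in> C0"
  by (simp add: C0_def)

lemma C0_add: "f \<in> C0 \<Longrightarrow> g \<in> C0 \<Longrightarrow> (\<lambda>x. f x + g x) \<in> C0"
  unfolding C0_def by (auto intro!: continuous_intros tendsto_add_zero)

lemma C0_cmult: "f \<in> C0 \<Longrightarrow> (\<lambda>x. c * f x) \<in> C0"
  unfolding C0_def by (auto intro!: continuous_intros tendsto_mult_right_zero)

lemma C0_minus: "f \<in> C0 \<Longrightarrow> (\<lambda>x. - f x) \<in> C0"
  using C0_cmult[of f "-1"] by simp

lemma C0_diff: "f \<in> C0 \<Longrightarrow> g \<in> C0 \<Longrightarrow> (\<lambda>x. f x - g x) \<in> C0"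
  using C0_add[OF _ C0_minus, of f g] by simp

lemma C0_translate:
  assumes "f \<in> C0"
  shows "(\<lambda>x. f (a + x)) \<in> C0"
  unfolding C0_iff
proof safe
  show "continuous_on UNIV (\<lambda>x. f (a + x))"
    by (intro continuous_on_compose2[OF C0_continuous[OF assms]] continuous_intros) auto
  fix e :: real assume "0 < e"
  then obtain R where R: "\<And>x. R \<le> norm x \<Longrightarrow> \<bar>f x\<bar> < e"
    using C0_small_outside[OF assms] by metis
  have "\<bar>f (a + x)\<bar> < e" if "R + norm a \<le> norm x" for x
    using that norm_triangle_ineq[of "a + x" "- a"] by (intro R) auto
  then show "\<exists>R. \<forall>x. R \<le> norm x \<longrightarrow> \<bar>f (a + x)\<bar> < e" by blast
qed

lemma C0_bounded:
  assumes "f \<in> C0"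
  obtains B where "0 \<le> B" "\<And>x. \<bar>f x\<bar> \<le> B"
proof -
  obtain R where R: "0 < R" "\<And>x. R \<le> norm x \<Longrightarrow> \<bar>f x\<bar> < 1"
    using C0_small_outside[OF assms, of 1] by auto
  have "bounded (f ` cball 0 R)"
    by (intro compact_imp_bounded compact_continuous_image continuous_on_subset[OF C0_continuous[OF assms]])
       auto
  then obtain B where "\<forall>y\<in>f ` cball 0 R. norm y \<le> B"
    unfolding bounded_iff by blast
  then have B: "\<bar>f x\<bar> \<le> B" if "norm x \<le> R" for x
    using that by simp
  have "\<bar>f x\<bar> \<le> max B 1" for x
    using R(2)[of x] B[of x] by (cases "norm x \<le> R") auto
  then show thesis
    by (intro that[of "max B 1"]) auto
qed

lemma C0_uniformly_continuous:
  assumes "f \<in> C0" "0 < e"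
  obtains d where "0 < d" "\<And>a x. norm a \<le> d \<Longrightarrow> \<bar>f (a + x) - f x\<bar> \<le> e"
proof -
  obtain R where R: "0 < R" "\<And>x. R \<le> norm x \<Longrightarrow> \<bar>f x\<bar> < e/2"
    using C0_small_outside[OF assms(1), of "e/2"] assms(2) by auto
  \<comment> \<open>The margin 1 matches the bound on the shift: if one of the two points lies in
    the ball of radius R, both lie in that of radius R + 1; otherwise both values are below
    e/2.\<close>
  have "uniformly_continuous_on (cball 0 (R + 1)) f"
    by (intro compact_uniformly_continuous continuous_on_subset[OF C0_continuous[OF assms(1)]]) auto
  then obtain d where d: "0 < d" 
    "\<And>x x'. norm x \<le> R + 1 \<Longrightarrow> norm x' \<le> R + 1 \<Longrightarrow> dist x' x < d \<Longrightarrow> dist (f x') (f x) < e"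
    using assms(2) by (auto simp: uniformly_continuous_on_def)
  show thesis
  proof (rule that[of "min 1 (d/2)"])
    fix a x :: 'a assume a: "norm a \<le> min 1 (d/2)"
    have 1: "norm (a + x) \<le> norm x + 1" "norm x \<le> norm (a + x) + 1"
      using a norm_triangle_ineq[of a x] norm_triangle_ineq[of "a + x" "- a"] by auto
    show "\<bar>f (a + x) - f x\<bar> \<le> e"
    proof (cases "norm x \<le> R \<or> norm (a + x) \<le> R")
      case True
      then have "dist (f (a + x)) (f x) < e"
        using 1 a d(1) by (intro d) (auto simp: dist_norm)
      then show ?thesis by (simp add: dist_real_def)
    next
      case False
      then show ?thesis using R(2)[of x] R(2)[of "a + x"] by auto
    qed
  qed (use d in auto)
qed

text \<open>Decay at infinity is not inherited by pointwise limits. It is obtained from fixed bounds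
  on both sides that already vanish at infinity.\<close>

lemma C0_squeeze:
  assumes l: "l \<in> C0" and u: "u \<in> C0" and f: "continuous_on UNIV f" and "\<And>x. l x \<le> f x" "\<And>x. f x \<le> u x"
  shows "f \<in> C0"
proof -
  have "(f \<longlongrightarrow> 0) at_infinity"
    by (rule real_tendsto_sandwich[of l f _ u]) (use assms in \<open>auto simp: C0_def\<close>)
  then show ?thesis using f by (simp add: C0_def)
qed

lemma continuous_of_modulus:
  fixes f :: "'a::real_normed_vector \<Rightarrow> real"
  assumes "\<And>e. 0 < e \<Longrightarrow> \<exists>d>0. \<forall>a x. norm a \<le> d \<longrightarrow> \<bar>f (a + x) - f x\<bar> \<le> e"
  shows "continuous_on UNIV f"
  unfolding continuous_on_iff
proof safe
  fix x and e :: real assume "0 < e"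
  with assms[of "e/2"] obtain d where d: "0 < d" "\<And>a x. norm a \<le> d \<Longrightarrow> \<bar>f (a + x) - f x\<bar> \<le> e/2"
    by auto
  have "dist (f y) (f x) < e" if "dist y x < d" for y
    using d(2)[of "y - x" x] that \<open>0 < e\<close> by (auto simp: dist_norm)
  with d(1) show "\<exists>d>0. \<forall>y\<in>UNIV. dist y x < d \<longrightarrow> dist (f y) (f x) < e" by blast
qed

text \<open>Non-compactness of the domain is harmless: outside a large ball already
  \<open>f 0 - g\<close> is small, and by monotonicity so are all later differences. On the ball the
  usual compactness argument applies.\<close>

lemma C0_Dini:
  fixes f :: "nat \<Rightarrow> 'a::euclidean_space \<Rightarrow> real"
  assumes f: "\<And>n. f n \<in> C0" and g: "g \<in> C0"
    and dec: "\<And>x. decseq (\<lambda>n. f n x)" and lim: "\<And>x. (\<lambda>n. f n x) \<longlonglongrightarrow> g x" and e: "0 < e"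
  obtains N where "\<And>n x. N \<le> n \<Longrightarrow> \<bar>f n x - g x\<bar> \<le> e"
proof -
  have ge: "g x \<le> f n x" for n x
    using decseq_ge[OF dec lim] .
  obtain R where R: "0 < R" "\<And>x. R \<le> norm x \<Longrightarrow> \<bar>f 0 x - g x\<bar> < e"
    using C0_small_outside[OF C0_diff[OF f[of 0] g] e] by blast
  define U where "U n = {x. f n x - g x < e}" for n
  have "open (U n)" for n
    unfolding U_def using C0_continuous[OF C0_diff[OF f[of n] g]]
    by (intro open_Collect_less) auto
  moreover have "cball 0 R \<subseteq> (\<Union>n. U n)"
  proof
    fix x
    have "\<forall>\<^sub>F n in sequentially. f n x < g x + e"
      using lim[of x] e by (intro order_tendstoD(2)) auto
    then obtain n where "f n x < g x + e"
      by (auto simp: eventually_sequentially)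
    then have "x \<in> U n" by (simp add: U_def)
    then show "x \<in> (\<Union>n. U n)" by blast
  qed
  ultimately obtain C where C: "finite C" "cball 0 R \<subseteq> (\<Union>n\<in>C. U n)"
    by (rule compactE_image[OF compact_cball, of UNIV U 0 R]) auto
  obtain N where N: "\<And>n. n \<in> C \<Longrightarrow> n \<le> N"
    using finite_nat_set_iff_bounded_le[of C] C(1) by auto
  show thesis
  proof (rule that)
    fix n x assume n: "N \<le> n"
    show "\<bar>f n x - g x\<bar> \<le> e"
    proof (cases "norm x \<le> R")
      case True
      then have "x \<in> (\<Union>n\<in>C. U n)" using C(2) by auto
      then obtain m where "m \<in> C" "f m x - g x < e"
        by (auto simp: U_def)
      then show ?thesis using N[of m] n decseqD[OF dec[of x], of m n] ge[of x n] by auto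
    next
      case False
      then show ?thesis using R(2)[of x] decseqD[OF dec[of x], of 0 n] ge[of x n] by auto
    qed
  qed
qed

section \<open>Translation-invariant sublinear operators\<close>

text \<open>The class shared by single steps, their iterates and the limit. Nonzero constants are
  not in \<open>C0\<close>, so the clause on upper bounds by c takes the place of preservation of
  constants; with c = 0 and subadditivity it yields monotonicity.\<close>

definition sublin_op :: "(('a::euclidean_space \<Rightarrow> real) \<Rightarrow> 'a \<Rightarrow> real) \<Rightarrow> bool" where
  "sublin_op P \<longleftrightarrow>
     (\<forall>f\<in>C0. P f \<in> C0) \<and>
     (\<forall>f\<in>C0. \<forall>g\<in>C0. \<forall>x. P (\<lambda>y. f y + g y) x \<le> P f x + P g x) \<and>
     (\<forall>c>0. \<forall>f\<in>C0. P (\<lambda>y. c * f y) = (\<lambda>x. c * P f x)) \<and>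
     (\<forall>f\<in>C0. \<forall>c. (\<forall>y. f y \<le> c) \<longrightarrow> (\<forall>x. P f x \<le> c)) \<and>
     (\<forall>f\<in>C0. \<forall>a. P (\<lambda>y. f (a + y)) = (\<lambda>x. P f (a + x)))"

context
  fixes P :: "('a::euclidean_space \<Rightarrow> real) \<Rightarrow> 'a \<Rightarrow> real"
  assumes P: "sublin_op P"
begin

lemma sublin_op_C0: "f \<in> C0 \<Longrightarrow> P f \<in> C0"
  and sublin_op_add: "f \<in> C0 \<Longrightarrow> g \<in> C0 \<Longrightarrow> P (\<lambda>y. f y + g y) x \<le> P f x + P g x"
  and sublin_op_scale: "0 < c \<Longrightarrow> f \<in> C0 \<Longrightarrow> P (\<lambda>y. c * f y) = (\<lambda>x. c * P f x)"
  and sublin_op_le: "f \<in> C0 \<Longrightarrow> (\<And>y. f y \<le> c) \<Longrightarrow> P f x \<le> c"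
  and sublin_op_translate: "f \<in> C0 \<Longrightarrow> P (\<lambda>y. f (a + y)) = (\<lambda>x. P f (a + x))"
  using P unfolding sublin_op_def by auto

lemma sublin_op_diff:
  assumes "f \<in> C0" "g \<in> C0"
  shows "P f x \<le> P g x + P (\<lambda>y. f y - g y) x"
  using sublin_op_add[OF assms(2) C0_diff[OF assms], of x] by simp

lemma sublin_op_mono:
  assumes "f \<in> C0" "g \<in> C0" "\<And>y. f y \<le> g y"
  shows "P f x \<le> P g x"
  using sublin_op_diff[OF assms(1,2), of x] sublin_op_le[OF C0_diff[OF assms(1,2)], of 0 x] assms(3)
  by auto

lemma sublin_op_zero: "P (\<lambda>_. 0) x = 0"
  using sublin_op_le[OF C0_zero, of 0 x] sublin_op_add[OF C0_zero C0_zero, of x] by auto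

text \<open>Subadditivity applied to f + (-f) = 0. It turns upper bounds valid for all functions
  into lower bounds.\<close>

lemma sublin_op_ge_minus:
  assumes "f \<in> C0"
  shows "- P (\<lambda>y. - f y) x \<le> P f x"
  using sublin_op_add[OF assms C0_minus[OF assms], of x] sublin_op_zero[of x] by simp

lemma sublin_op_ge:
  assumes "f \<in> C0" "\<And>y. c \<le> f y"
  shows "c \<le> P f x"
  using sublin_op_ge_minus[OF assms(1), of x] sublin_op_le[OF C0_minus[OF assms(1)], of "- c" x] assms(2)
  by simp

lemma sublin_op_contraction:
  assumes "f \<in> C0" "g \<in> C0" "\<And>y. \<bar>f y - g y\<bar> \<le> e"
  shows "\<bar>P f x - P g x\<bar> \<le> e"
  using sublin_op_diff[OF assms(1,2), of x] sublin_op_diff[OF assms(2,1), of x]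
    sublin_op_le[OF C0_diff[OF assms(1,2)], of e x] sublin_op_le[OF C0_diff[OF assms(2,1)], of e x] assms(3)
  by (auto simp: abs_le_iff)

text \<open>Shifting the result is the same as shifting the argument, so the contraction property
  compares the two shifts. The bound does not depend on P, which makes the iterates
  equicontinuous.\<close>

lemma sublin_op_modulus:
  assumes "f \<in> C0" "\<And>y. \<bar>f (a + y) - f y\<bar> \<le> e"
  shows "\<bar>P f (a + x) - P f x\<bar> \<le> e"
  using sublin_op_contraction[OF C0_translate[OF assms(1)] assms(1), of a e x] assms
    sublin_op_translate[OF assms(1), of a] by simp

end

lemma sublin_op_comp:
  assumes P: "sublin_op P" and Q: "sublin_op Q"
  shows "sublin_op (\<lambda>f. P (Q f))"
  unfolding sublin_op_def
proof (intro conjI ballI allI impI)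
  fix f g :: "'a \<Rightarrow> real" and x assume f: "f \<in> C0" and g: "g \<in> C0"
  note QC = sublin_op_C0[OF Q]
  have "P (Q (\<lambda>y. f y + g y)) x \<le> P (\<lambda>y. Q f y + Q g y) x"
    using f g by (intro sublin_op_mono[OF P] sublin_op_add[OF Q] QC C0_add)
  also have "\<dots> \<le> P (Q f) x + P (Q g) x"
    using f g by (intro sublin_op_add[OF P] QC)
  finally show "P (Q (\<lambda>y. f y + g y)) x \<le> P (Q f) x + P (Q g) x" .
next
  fix f :: "'a \<Rightarrow> real" and c x assume f: "f \<in> C0" and c: "\<forall>y. f y \<le> c"
  have "Q f y \<le> c" for y
    using c by (intro sublin_op_le[OF Q f]) auto
  then show "P (Q f) x \<le> c"
    by (rule sublin_op_le[OF P sublin_op_C0[OF Q f]])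
qed (simp_all add: sublin_op_C0[OF P] sublin_op_C0[OF Q] sublin_op_scale[OF P] sublin_op_scale[OF Q]
      sublin_op_translate[OF P] sublin_op_translate[OF Q])

lemma sublin_op_funpow: "sublin_op P \<Longrightarrow> sublin_op (P ^^ k)"
proof (induction k)
  case 0
  show ?case by (simp add: sublin_op_def)
next
  case (Suc k)
  then show ?case using sublin_op_comp[of P "P ^^ k"] by (simp add: comp_def)
qed

lemma sublin_op_decseq_convergent:
  assumes P: "\<And>n. sublin_op (P n)" and f: "f \<in> C0" and dec: "decseq (\<lambda>n. P n f x)"
  shows "convergent (\<lambda>n. P n f x)"
proof -
  obtain B where B: "0 \<le> B" "\<And>x. \<bar>f x\<bar> \<le> B"
    using C0_bounded[OF f] by blast
  have "- B \<le> f y" for y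
    using B(2)[of y] by linarith
  then have "- B \<le> P n f x" for n
    by (intro sublin_op_ge[OF P f])
  then obtain l where "(\<lambda>n. P n f x) \<longlonglongrightarrow> l"
    using decseq_convergent[OF dec, of "- B"] by blast
  then show ?thesis by (rule convergentI)
qed

lemma sublin_op_lim:
  fixes P :: "nat \<Rightarrow> ('a::euclidean_space \<Rightarrow> real) \<Rightarrow> 'a \<Rightarrow> real"
  assumes P: "\<And>n. sublin_op (P n)" and dec: "\<And>f x. f \<in> C0 \<Longrightarrow> decseq (\<lambda>n. P n f x)"
  shows "sublin_op (\<lambda>f x. lim (\<lambda>n. P n f x))"
proof -
  define L where "L = (\<lambda>f x. lim (\<lambda>n. P n f x))"
  have L: "(\<lambda>n. P n f x) \<longlonglongrightarrow> L f x" if "f \<in> C0" for f x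
    using sublin_op_decseq_convergent[where P = P and f = f and x = x] P dec that
    unfolding L_def convergent_LIMSEQ_iff by blast
  have add: "L (\<lambda>y. f y + g y) x \<le> L f x + L g x" if "f \<in> C0" "g \<in> C0" for f g x
  proof (rule LIMSEQ_le)
    show "(\<lambda>n. P n (\<lambda>y. f y + g y) x) \<longlonglongrightarrow> L (\<lambda>y. f y + g y) x"
      by (rule L[OF C0_add[OF that]])
    show "(\<lambda>n. P n f x + P n g x) \<longlonglongrightarrow> L f x + L g x"
      by (intro tendsto_add L that)
    show "\<exists>N. \<forall>n\<ge>N. P n (\<lambda>y. f y + g y) x \<le> P n f x + P n g x"
      using sublin_op_add[OF P that] by blast
  qed
  have zero: "L (\<lambda>_. 0) x = 0" for x
    unfolding L_def sublin_op_zero[OF P] by simp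
  have C0: "L f \<in> C0" if f: "f \<in> C0" for f
  proof (rule C0_squeeze[of "\<lambda>x. - P 0 (\<lambda>y. - f y) x" "P 0 f"])
    show "P 0 f \<in> C0"
      by (rule sublin_op_C0[OF P f])
    show "(\<lambda>x. - P 0 (\<lambda>y. - f y) x) \<in> C0"
      by (rule C0_minus[OF sublin_op_C0[OF P C0_minus[OF f]]])
    have le: "L f x \<le> P 0 f x" if "f \<in> C0" for f x
      using decseq_ge[OF dec[OF that] L[OF that]] .
    then show "L f x \<le> P 0 f x" for x using f .
    \<comment> \<open>Monotonicity in n bounds the limit only from above. Applied to -f and combined
      with subadditivity of the limit, it also gives the lower bound needed for the squeeze.\<close>
    have "0 \<le> L f x + L (\<lambda>y. - f y) x" for x
      using add[OF f C0_minus[OF f], of x] zero by simp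
    then show "- P 0 (\<lambda>y. - f y) x \<le> L f x" for x
      using le[OF C0_minus[OF f], of x] by (smt (verit))
    show "continuous_on UNIV (L f)"
    proof (rule continuous_of_modulus)
      fix e :: real assume "0 < e"
      then obtain d where d: "0 < d" "\<And>a x. norm a \<le> d \<Longrightarrow> \<bar>f (a + x) - f x\<bar> \<le> e"
        using C0_uniformly_continuous[OF f] by blast
      have "\<bar>L f (a + x) - L f x\<bar> \<le> e" if "norm a \<le> d" for a x
      proof (rule LIMSEQ_le_const2)
        show "(\<lambda>n. \<bar>P n f (a + x) - P n f x\<bar>) \<longlonglongrightarrow> \<bar>L f (a + x) - L f x\<bar>"
          by (intro tendsto_rabs tendsto_diff L[OF f])
        show "\<exists>N. \<forall>n\<ge>N. \<bar>P n f (a + x) - P n f x\<bar> \<le> e"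
          using sublin_op_modulus[OF P f d(2)[OF that]] by blast
      qed
      with d(1) show "\<exists>d>0. \<forall>a x. norm a \<le> d \<longrightarrow> \<bar>L f (a + x) - L f x\<bar> \<le> e" by blast
    qed
  qed
  have "sublin_op L"
    unfolding sublin_op_def
  proof (intro conjI ballI allI impI)
    fix f :: "'a \<Rightarrow> real" and c x assume f: "f \<in> C0" and c: "\<forall>y. f y \<le> c"
    show "L f x \<le> c"
      by (rule LIMSEQ_le_const2[OF L[OF f]]) (use sublin_op_le[OF P f] c in auto)
  next
    fix f :: "'a \<Rightarrow> real" and c :: real assume f: "f \<in> C0" and c: "0 < c"
    show "L (\<lambda>y. c * f y) = (\<lambda>x. c * L f x)"
    proof
      fix x
      have "(\<lambda>n. P n (\<lambda>y. c * f y) x) \<longlonglongrightarrow> c * L f x"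
        unfolding sublin_op_scale[OF P c f] by (rule tendsto_mult_left[OF L[OF f]])
      then show "L (\<lambda>y. c * f y) x = c * L f x" unfolding L_def by (rule limI)
    qed
  next
    fix f :: "'a \<Rightarrow> real" and a assume f: "f \<in> C0"
    show "L (\<lambda>y. f (a + y)) = (\<lambda>x. L f (a + x))"
      unfolding L_def sublin_op_translate[OF P f] ..
  qed (auto intro: C0 add)
  then show ?thesis by (simp add: L_def)
qed

section \<open>Semigroups from monotone dyadic limits\<close>

text \<open>\<open>T_sub_pos\<close> is restricted to positive times because the increments of the
  process are taken over strictly increasing times. The closed interval in \<open>T_cont\<close>
  contains 0, which forces \<open>T 0\<close> to be the identity on \<open>C0\<close> and recovers
  the remaining cases.\<close>

locale subsemigroup =
  fixes T :: "real \<Rightarrow> ('a::euclidean_space \<Rightarrow> real) \<Rightarrow> 'a \<Rightarrow> real"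
  assumes T_op: "0 \<le> t \<Longrightarrow> sublin_op (T t)"
    and T_sub_pos: "0 < s \<Longrightarrow> 0 < t \<Longrightarrow> f \<in> C0 \<Longrightarrow> T t (T s f) x \<le> T (t + s) f x"
    and T_cont: "f \<in> C0 \<Longrightarrow> 0 < e \<Longrightarrow> \<exists>h>0. \<forall>t\<in>{0..h}. \<forall>x. \<bar>T t f x - f x\<bar> \<le> e"
begin

definition D :: "nat \<Rightarrow> real \<Rightarrow> ('a \<Rightarrow> real) \<Rightarrow> 'a \<Rightarrow> real" where
  "D n t f = (let k = nat \<lfloor>2 ^ n * t\<rfloor> in (T (1 / 2 ^ n) ^^ k) (T (t - real k / 2 ^ n) f))"

definition L :: "real \<Rightarrow> ('a \<Rightarrow> real) \<Rightarrow> 'a \<Rightarrow> real" where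
  "L t f x = lim (\<lambda>n. D n t f x)"

lemma T_0:
  assumes "f \<in> C0"
  shows "T 0 f = f"
proof
  fix x
  have "\<bar>T 0 f x - f x\<bar> \<le> e" if "0 < e" for e
    using T_cont[OF assms that] by auto
  then have "\<bar>T 0 f x - f x\<bar> \<le> 0" by (rule field_le_epsilon) auto
  then show "T 0 f x = f x" by simp
qed

lemma T_sub:
  assumes "0 \<le> s" "0 \<le> t" "f \<in> C0"
  shows "T t (T s f) x \<le> T (t + s) f x"
proof (cases "0 < s \<and> 0 < t")
  case True
  with assms show ?thesis by (simp add: T_sub_pos)
next
  case False
  with assms have "s = 0 \<or> t = 0" by auto
  then show ?thesis
    using T_0[OF assms(3)] T_0[OF sublin_op_C0[OF T_op[OF assms(1)] assms(3)]] by auto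
qed

lemma step_op: "sublin_op (T (1 / 2 ^ n))"
  by (rule T_op) simp

lemma funpow_sub:
  assumes "0 \<le> h" "0 \<le> s" "f \<in> C0"
  shows "(T h ^^ k) (T s f) x \<le> T (real k * h + s) f x"
proof (induction k arbitrary: x)
  case (Suc k)
  have "(T h ^^ Suc k) (T s f) x = T h ((T h ^^ k) (T s f)) x" by simp
  also have "\<dots> \<le> T h (T (real k * h + s) f) x"
    using assms
    by (intro sublin_op_mono[OF T_op] Suc sublin_op_C0[OF sublin_op_funpow] sublin_op_C0[OF T_op] T_op) auto
  also have "\<dots> \<le> T (h + (real k * h + s)) f x"
    using assms by (intro T_sub) auto
  finally show ?case by (simp add: algebra_simps)
qed simp

lemma grid_below:
  fixes t :: real
  assumes "0 \<le> t"
  shows "real (nat \<lfloor>2 ^ n * t\<rfloor>) / 2 ^ n \<le> t" "t - real (nat \<lfloor>2 ^ n * t\<rfloor>) / 2 ^ n < 1 / 2 ^ n"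
proof -
  have "real (nat \<lfloor>2 ^ n * t\<rfloor>) = of_int \<lfloor>2 ^ n * t\<rfloor>"
    using assms by simp
  moreover have "of_int \<lfloor>2 ^ n * t\<rfloor> \<le> 2 ^ n * t" "2 ^ n * t < of_int \<lfloor>2 ^ n * t\<rfloor> + 1"
    by linarith+
  ultimately show "real (nat \<lfloor>2 ^ n * t\<rfloor>) / 2 ^ n \<le> t" "t - real (nat \<lfloor>2 ^ n * t\<rfloor>) / 2 ^ n < 1 / 2 ^ n"
    by (simp_all add: pos_divide_le_eq diff_less_eq add_divide_distrib[symmetric] pos_less_divide_eq
        mult.commute add.commute)
qed

lemma D_op:
  assumes "0 \<le> t"
  shows "sublin_op (D n t)"
proof -
  have "sublin_op (\<lambda>f. (T (1 / 2 ^ n) ^^ k) (T (t - real k / 2 ^ n) f))" if "real k / 2 ^ n \<le> t" for k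
    by (rule sublin_op_comp[where P = "T (1 / 2 ^ n) ^^ k" and Q = "T (t - real k / 2 ^ n)"])
       (use that in \<open>simp_all add: sublin_op_funpow step_op T_op\<close>)
  from this[OF grid_below(1)[OF assms]] show ?thesis
    by (simp add: D_def[abs_def] Let_def)
qed

lemma D_le_T:
  assumes "0 \<le> t" "f \<in> C0"
  shows "D n t f x \<le> T t f x"
  using funpow_sub[of "1 / 2 ^ n" "t - real (nat \<lfloor>2 ^ n * t\<rfloor>) / 2 ^ n" f "nat \<lfloor>2 ^ n * t\<rfloor>" x]
    grid_below(1)[OF assms(1), of n] assms
  by (simp add: D_def Let_def)

text \<open>Adding grid steps leaves the remainder of s unchanged and only adds full steps on the
  outside.\<close>

lemma D_grid_add:
  assumes "0 \<le> s"
  shows "D n (real j / 2 ^ n + s) f = (T (1 / 2 ^ n) ^^ j) (D n s f)"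
proof -
  have "\<lfloor>2 ^ n * (real j / 2 ^ n + s)\<rfloor> = int j + \<lfloor>2 ^ n * s\<rfloor>"
    by (simp add: algebra_simps)
  then have k: "nat \<lfloor>2 ^ n * (real j / 2 ^ n + s)\<rfloor> = j + nat \<lfloor>2 ^ n * s\<rfloor>"
    using assms by (simp add: nat_add_distrib)
  show ?thesis
    unfolding D_def k Let_def by (simp add: funpow_add add_divide_distrib)
qed

lemma D_small:
  assumes "0 \<le> s" "s < 1 / 2 ^ n"
  shows "D n s f = T s f"
proof -
  have "\<lfloor>2 ^ n * s\<rfloor> = 0"
    using assms by (simp add: floor_eq_iff field_simps)
  then show ?thesis by (simp add: D_def)
qed

lemma D_grid:
  assumes "f \<in> C0"
  shows "D n (real j / 2 ^ n) f = (T (1 / 2 ^ n) ^^ j) f"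
  using D_grid_add[of 0 n j f] D_small[of 0 n f] T_0[OF assms] by simp

text \<open>Two fine steps are dominated by one coarse step through \<open>T_sub\<close>;
  monotonicity of the coarse step carries this through the iteration.\<close>

lemma double_step:
  assumes "f \<in> C0"
  shows "(T (1 / 2 ^ Suc n) ^^ (2 * k)) f x \<le> (T (1 / 2 ^ n) ^^ k) f x"
proof (induction k arbitrary: x)
  case (Suc k)
  let ?h = "1 / 2 ^ Suc n"
  have C: "(T ?h ^^ j) f \<in> C0" for j
    using assms by (rule sublin_op_C0[OF sublin_op_funpow[OF step_op]])
  have C': "(T (1 / 2 ^ n) ^^ j) f \<in> C0" for j
    using assms by (rule sublin_op_C0[OF sublin_op_funpow[OF step_op]])
  have "(T ?h ^^ (2 * Suc k)) f x = T ?h (T ?h ((T ?h ^^ (2 * k)) f)) x" by simp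
  also have "\<dots> \<le> T (?h + ?h) ((T ?h ^^ (2 * k)) f) x"
    by (intro T_sub C) auto
  also have "\<dots> = T (1 / 2 ^ n) ((T ?h ^^ (2 * k)) f) x" by simp
  also have "\<dots> \<le> T (1 / 2 ^ n) ((T (1 / 2 ^ n) ^^ k) f) x"
    by (intro sublin_op_mono[OF step_op] C C' Suc)
  finally show ?case by simp
qed simp

lemma D_Suc_le:
  assumes t: "0 \<le> t" and f: "f \<in> C0"
  shows "D (Suc n) t f x \<le> D n t f x"
proof -
  define k where "k = nat \<lfloor>2 ^ n * t\<rfloor>"
  define s where "s = t - real k / 2 ^ n"
  have s: "0 \<le> s" "s < 1 / 2 ^ n"
    using grid_below[OF t, of n] by (auto simp: s_def k_def)
  have t1: "t = real k / 2 ^ n + s" by (simp add: s_def)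
  then have t2: "t = real (2 * k) / 2 ^ Suc n + s" by simp
  \<comment> \<open>The remainder s may exceed the finer mesh, so \<open>D (Suc n) s\<close> can
    consist of a full step and a smaller remainder; either way it lies below
    \<open>T s\<close>.\<close>
  have small: "D (Suc n) s f x \<le> T s f x" for x
    using s f by (intro D_le_T)
  have C: "D (Suc n) s f \<in> C0" "T s f \<in> C0"
    using s f by (auto intro: sublin_op_C0[OF D_op] sublin_op_C0[OF T_op])
  have "D (Suc n) t f x = (T (1 / 2 ^ Suc n) ^^ (2 * k)) (D (Suc n) s f) x"
    unfolding t2 D_grid_add[OF s(1)] ..
  also have "\<dots> \<le> (T (1 / 2 ^ n) ^^ k) (D (Suc n) s f) x"
    by (rule double_step[OF C(1)])
  also have "\<dots> \<le> (T (1 / 2 ^ n) ^^ k) (T s f) x"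
    by (intro sublin_op_mono[OF sublin_op_funpow[OF step_op]] C small)
  also have "\<dots> = D n t f x"
    unfolding t1 D_grid_add[OF s(1)] D_small[OF s] ..
  finally show ?thesis .
qed

lemma D_decseq: "0 \<le> t \<Longrightarrow> f \<in> C0 \<Longrightarrow> decseq (\<lambda>n. D n t f x)"
  by (intro decseq_SucI D_Suc_le)

lemma D_convergent: "0 \<le> t \<Longrightarrow> f \<in> C0 \<Longrightarrow> convergent (\<lambda>n. D n t f x)"
  using sublin_op_decseq_convergent[where P = "\<lambda>n. D n t" and f = f and x = x] D_op D_decseq by blast

lemma D_tendsto: "0 \<le> t \<Longrightarrow> f \<in> C0 \<Longrightarrow> (\<lambda>n. D n t f x) \<longlonglongrightarrow> L t f x"
  using D_convergent[of t f x] by (simp add: L_def convergent_LIMSEQ_iff)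

lemma L_op: "0 \<le> t \<Longrightarrow> sublin_op (L t)"
  unfolding L_def[abs_def]
  by (rule sublin_op_lim[where P = "\<lambda>n. D n t"]) (simp_all add: D_op D_decseq)

lemma L_le_D: "0 \<le> t \<Longrightarrow> f \<in> C0 \<Longrightarrow> L t f x \<le> D n t f x"
  using decseq_ge[OF D_decseq D_tendsto] .

lemma L_le_T: "0 \<le> t \<Longrightarrow> f \<in> C0 \<Longrightarrow> L t f x \<le> T t f x"
  using L_le_D[of t f x 0] D_le_T[of t f 0 x] by simp

section \<open>Continuity in time and the semigroup law\<close>

lemma L_near_id:
  assumes f: "f \<in> C0" and e: "0 < e"
  shows "\<exists>h>0. \<forall>t\<in>{0..h}. \<forall>x. \<bar>L t f x - f x\<bar> \<le> e"
proof -
  note f' = C0_minus[OF f]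
  obtain h where h: "0 < h" "\<And>t x. 0 \<le> t \<Longrightarrow> t \<le> h \<Longrightarrow> \<bar>T t f x - f x\<bar> \<le> e"
    using T_cont[OF f e] by auto
  obtain h' where h': "0 < h'" "\<And>t x. 0 \<le> t \<Longrightarrow> t \<le> h' \<Longrightarrow> \<bar>T t (\<lambda>y. - f y) x - - f x\<bar> \<le> e"
    using T_cont[OF f' e] by auto
  \<comment> \<open>From above, L f \<le> T f \<le> f + e; from below, L f \<ge> -L(-f) \<ge> -T(-f)
    \<ge> f - e. This is why a second time h' for -f is needed.\<close>
  have "\<bar>L t f x - f x\<bar> \<le> e" if "0 \<le> t" "t \<le> min h h'" for t x
    using h(2)[of t x] h'(2)[of t x] L_le_T[OF that(1) f, of x] L_le_T[OF that(1) f', of x]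
      sublin_op_ge_minus[OF L_op[OF that(1)] f, of x] that by (auto simp: abs_le_iff)
  with h(1) h'(1) show ?thesis by (intro exI[of _ "min h h'"]) auto
qed

lemma L_0:
  assumes "f \<in> C0"
  shows "L 0 f = f"
  using D_grid[OF assms, of _ 0] by (auto simp: L_def)

text \<open>For a grid time the law already holds exactly for \<open>D n\<close> once n \<ge> m. The
  limit on the inside can then be taken because the outer operators are contractions and the inner
  convergence is uniform.\<close>

lemma L_grid_add:
  assumes s: "0 \<le> s" and f: "f \<in> C0"
  shows "L (real j / 2 ^ m) (L s f) = L (real j / 2 ^ m + s) f"
proof
  fix x
  define t where "t = real j / 2 ^ m"
  have t: "0 \<le> t" by (simp add: t_def)
  have Ls: "L s f \<in> C0" using s f by (rule sublin_op_C0[OF L_op])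
  have Ds: "D n s f \<in> C0" for n using s f by (rule sublin_op_C0[OF D_op])
  have D: "D n t (D n s f) = D n (t + s) f" if "m \<le> n" for n
  proof -
    \<comment> \<open>A grid point of level m is also one of every finer level n, with index
      multiplied by \<open>2 ^ (n - m)\<close>.\<close>
    have t': "t = real (j * 2 ^ (n - m)) / 2 ^ n"
      using that by (simp add: t_def field_simps flip: power_add)
    show ?thesis unfolding t' D_grid[OF Ds] D_grid_add[OF s] ..
  qed
  \<comment> \<open>Both the outer operator and its argument vary with n, so pointwise convergence
    of \<open>D n s f\<close> would not be enough; Dini's theorem supplies the uniform
    bound.\<close>
  have "(\<lambda>n. D n (t + s) f x - D n t (L s f) x) \<longlonglongrightarrow> 0"
  proof (rule LIMSEQ_I)
    fix r :: real assume "0 < r"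
    then obtain N where N: "\<And>n x. N \<le> n \<Longrightarrow> \<bar>D n s f x - L s f x\<bar> \<le> r/2"
      using C0_Dini[OF Ds Ls D_decseq[OF s f] D_tendsto[OF s f], of "r/2"] by auto
    have "norm (D n (t + s) f x - D n t (L s f) x - 0) < r" if "max N m \<le> n" for n
      using sublin_op_contraction[OF D_op[OF t] Ds Ls, of n "r/2" n x] N[of n] that D[of n] \<open>0 < r\<close> by auto
    then show "\<exists>N. \<forall>n\<ge>N. norm (D n (t + s) f x - D n t (L s f) x - 0) < r" by blast
  qed
  moreover have "(\<lambda>n. D n (t + s) f x - D n t (L s f) x) \<longlonglongrightarrow> L (t + s) f x - L t (L s f) x"
    using s t f Ls by (intro tendsto_diff D_tendsto) auto
  ultimately have "L (t + s) f x - L t (L s f) x = 0"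
    using LIMSEQ_unique by blast
  then show "L (real j / 2 ^ m) (L s f) x = L (real j / 2 ^ m + s) f x"
    by (simp add: t_def)
qed

lemma obtain_grid_below:
  fixes t e :: real
  assumes "0 \<le> t" "0 < e"
  obtains j m where "real j / 2 ^ m \<le> t" "t - real j / 2 ^ m < e"
proof -
  obtain m where "(1/2) ^ m < e"
    using real_arch_pow_inv[of e "1/2"] assms by auto
  then have "1 / 2 ^ m < e" by (simp add: power_divide)
  then show thesis
    using that[OF grid_below(1)[OF assms(1), of m]] grid_below(2)[OF assms(1), of m] by linarith
qed

text \<open>The semigroup law is so far available only for dyadic first factors. A grid point r just
  below a is split off from both a and b; the rests a - r and b - r lie in the interval where L is
  near the identity, and \<open>L r\<close> is a contraction. Hence h does not depend on a.\<close>

lemma L_time_cont: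
  assumes f: "f \<in> C0" and e: "0 < e"
  obtains h where "0 < h" "\<And>a b x. 0 \<le> a \<Longrightarrow> a \<le> b \<Longrightarrow> b \<le> a + h \<Longrightarrow> \<bar>L b f x - L a f x\<bar> \<le> e"
proof -
  obtain h where h: "0 < h" "\<And>t x. 0 \<le> t \<Longrightarrow> t \<le> h \<Longrightarrow> \<bar>L t f x - f x\<bar> \<le> e/2"
    using L_near_id[OF f, of "e/2"] e by auto
  have "\<bar>L b f x - L a f x\<bar> \<le> e" if ab: "0 \<le> a" "a \<le> b" "b \<le> a + h/2" for a b x
  proof -
    obtain j m where r: "real j / 2 ^ m \<le> a" "a - real j / 2 ^ m < h/2"
      using obtain_grid_below[OF ab(1), of "h/2"] h(1) by auto
    define r where "r = real j / 2 ^ m"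
    note r = r[folded r_def]
    have a: "L a f = L r (L (a - r) f)" "L b f = L r (L (b - r) f)"
      using L_grid_add[of "a - r" f j m] L_grid_add[of "b - r" f j m] r ab f by (auto simp: r_def)
    have C: "L (a - r) f \<in> C0" "L (b - r) f \<in> C0" and "0 \<le> r"
      using r ab f by (auto intro: sublin_op_C0[OF L_op] simp: r_def)
    have "\<bar>L (b - r) f y - L (a - r) f y\<bar> \<le> e" for y
    proof -
      have "\<bar>L (b - r) f y - f y\<bar> \<le> e/2" "\<bar>L (a - r) f y - f y\<bar> \<le> e/2"
        by (rule h(2); use r ab in linarith)+
      then show ?thesis by linarith
    qed
    then show ?thesis
      unfolding a using C \<open>0 \<le> r\<close> by (intro sublin_op_contraction[OF L_op])
  qed
  with h(1) show thesis by (intro that[of "h/2"]) auto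
qed

text \<open>For fixed s both sides are continuous in t, the left one being the evolution of
  \<open>L s f\<close>, and they agree at grid times.\<close>

lemma L_semigroup:
  assumes s: "0 \<le> s" and t: "0 \<le> t" and f: "f \<in> C0"
  shows "L t (L s f) = L (t + s) f"
proof
  fix x
  have Ls: "L s f \<in> C0" using s f by (rule sublin_op_C0[OF L_op])
  have "\<bar>L t (L s f) x - L (t + s) f x\<bar> \<le> 0"
  proof (rule field_le_epsilon)
    fix e :: real assume e: "0 < e"
    obtain h where h: "0 < h"
        "\<And>a b x. 0 \<le> a \<Longrightarrow> a \<le> b \<Longrightarrow> b \<le> a + h \<Longrightarrow> \<bar>L b f x - L a f x\<bar> \<le> e/2"
      using L_time_cont[OF f, of "e/2"] e by auto
    obtain h' where h': "0 < h'"
        "\<And>a b x. 0 \<le> a \<Longrightarrow> a \<le> b \<Longrightarrow> b \<le> a + h' \<Longrightarrow> \<bar>L b (L s f) x - L a (L s f) x\<bar> \<le> e/2"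
      using L_time_cont[OF Ls, of "e/2"] e by auto
    obtain j m where r: "real j / 2 ^ m \<le> t" "t - real j / 2 ^ m < min h h'"
      using obtain_grid_below[OF t, of "min h h'"] h(1) h'(1) by auto
    have "\<bar>L t (L s f) x - L (real j / 2 ^ m) (L s f) x\<bar> \<le> e/2"
      using r by (intro h') auto
    moreover have "\<bar>L (t + s) f x - L (real j / 2 ^ m + s) f x\<bar> \<le> e/2"
      using r s by (intro h) auto
    ultimately show "\<bar>L t (L s f) x - L (t + s) f x\<bar> \<le> 0 + e"
      unfolding L_grid_add[OF s f] by linarith
  qed
  then show "L t (L s f) x = L (t + s) f x" by simp
qed

end

section \<open>Moment estimates and convolutions\<close>

lemma powr_convex_nonneg:
  fixes a b u v p :: real
  assumes p: "1 \<le> p" and nonneg: "0 \<le> a" "0 \<le> b" "0 \<le> u" "0 \<le> v" and ab: "a + b = 1"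
  shows "(a * u + b * v) powr p \<le> a * u powr p + b * v powr p"
proof (cases "0 < u \<and> 0 < v")
  case True
  then show ?thesis
    using convex_onD[OF powr_convex[OF p], of b u v] nonneg ab by (simp add: eq_diff_eq[symmetric])
next
  case False
  \<comment> \<open>If one of the points is 0, the claim reduces to a powr p \<le> a for a weight a
    in [0, 1].\<close>
  have 1: "c powr p \<le> c" if "0 \<le> c" "c \<le> 1" for c :: real
    using powr_mono'[of 1 p c] p that by auto
  from False have "u = 0 \<or> v = 0" using nonneg by auto
  then show ?thesis
    using 1[of a] 1[of b] nonneg ab p by (auto simp: powr_mult intro!: mult_right_mono)
qed

text \<open>Convexity for the weights a/(a + b) and b/(a + b) at the points norm x / a and norm y /
  b. With a and b bounding the p-norms of two random variables, the bracket integrates to at most 1,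
  which is Minkowski's inequality.\<close>

lemma norm_add_powr_le:
  fixes x y :: "'a::real_normed_vector"
  assumes p: "1 \<le> p" and a: "0 < a" and b: "0 < b"
  shows "norm (x + y) powr p \<le>
    (a + b) powr p * (a / (a + b) / a powr p * norm x powr p + b / (a + b) / b powr p * norm y powr p)"
proof -
  have "norm (x + y) powr p \<le> ((a + b) * (a / (a + b) * (norm x / a) + b / (a + b) * (norm y / b))) powr p"
    using p a b norm_triangle_ineq[of x y]
    by (intro powr_mono2) (auto simp: add_divide_distrib[symmetric])
  also have "\<dots> = (a + b) powr p * (a / (a + b) * (norm x / a) + b / (a + b) * (norm y / b)) powr p"
    using a b by (subst powr_mult) auto
  also have "\<dots> \<le> (a + b) powr p *
      (a / (a + b) * (norm x / a) powr p + b / (a + b) * (norm y / b) powr p)"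
    using a b p by (intro mult_left_mono powr_convex_nonneg) (auto simp: add_divide_distrib[symmetric])
  finally show ?thesis
    using a b by (simp add: powr_divide)
qed

lemma norm_add_powr_le':
  fixes x y :: "'a::real_normed_vector"
  assumes p: "1 \<le> p"
  shows "norm (x + y) powr p \<le> 2 powr p * (norm x powr p + norm y powr p)"
proof -
  have "norm (x + y) powr p \<le> 2 powr p * (1/2 * norm x powr p + 1/2 * norm y powr p)"
    using norm_add_powr_le[OF p, of 1 1 x y] by simp
  also have "\<dots> \<le> 2 powr p * (norm x powr p + norm y powr p)"
    by (intro mult_left_mono add_mono) (simp_all add: mult_left_le_one_le)
  finally show ?thesis .
qed

lemma borel_measurable_fst_borel [measurable]:
  "fst \<in> borel_measurable (borel :: ('a::euclidean_space \<times> 'b::euclidean_space) measure)"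
  and borel_measurable_snd_borel [measurable]:
  "snd \<in> borel_measurable (borel :: ('a::euclidean_space \<times> 'b::euclidean_space) measure)"
  by (intro borel_measurable_continuous_onI continuous_intros)+

lemma (in prob_space) abs_integral_le_small:
  fixes g h :: "'a \<Rightarrow> real"
  assumes [measurable]: "g \<in> borel_measurable M" "h \<in> borel_measurable M"
    and B: "0 \<le> B" "\<And>z. \<bar>g z\<bar> \<le> B" and e: "0 \<le> e" "\<And>z. h z \<le> d \<Longrightarrow> \<bar>g z\<bar> \<le> e"
  shows "\<bar>\<integral>z. g z \<partial>M\<bar> \<le> e + B * prob {z \<in> space M. d < h z}"
proof -
  let ?A = "{z \<in> space M. d < h z}"
  have i: "integrable M (\<lambda>z. e + B * indicator ?A z)"
    by (intro integrable_const_bound[where B = "e + B"]) (use B e in \<open>auto simp: indicator_def\<close>)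
  have "\<bar>\<integral>z. g z \<partial>M\<bar> \<le> (\<integral>z. \<bar>g z\<bar> \<partial>M)"
    by (rule integral_abs_bound)
  also have "\<dots> \<le> (\<integral>z. e + B * indicator ?A z \<partial>M)"
  proof (rule integral_mono[OF _ i])
    show "integrable M (\<lambda>z. \<bar>g z\<bar>)"
      by (intro integrable_const_bound[where B = B]) (use B in auto)
    fix z assume "z \<in> space M"
    then show "\<bar>g z\<bar> \<le> e + B * indicator ?A z"
      using B(2)[of z] e(2)[of z] e(1) by (cases "h z \<le> d") (auto simp: indicator_def)
  qed
  also have "\<dots> = e + B * prob ?A"
    by (subst Bochner_Integration.integral_add)
       (auto simp: prob_space emeasure_eq_measure intro!: integrable_mult_right integrable_real_indicator)
  finally show ?thesis .
qed

lemma (in prob_space) prob_norm_gt_le: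
  fixes Z :: "'a \<Rightarrow> 'b::euclidean_space"
  assumes [measurable]: "Z \<in> borel_measurable M" and d: "0 < d" and p: "0 < p" and C: "0 \<le> C"
    and le: "(\<integral>\<^sup>+z. ennreal (norm (Z z) powr p) \<partial>M) \<le> ennreal C"
  shows "prob {z \<in> space M. d < norm (Z z)} \<le> C / d powr p"
proof -
  have "{z \<in> space M. d < norm (Z z)} \<subseteq> {z \<in> space M. 1 \<le> ennreal (1 / d powr p) * ennreal (norm (Z z) powr p)}"
  proof safe
    fix z assume "d < norm (Z z)"
    then have "d powr p \<le> norm (Z z) powr p"
      using d p by (intro powr_mono2) auto
    then show "1 \<le> ennreal (1 / d powr p) * ennreal (norm (Z z) powr p)"
      using d by (simp add: ennreal_mult[symmetric] ennreal_1[symmetric] del: ennreal_1)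
  qed
  then have "emeasure M {z \<in> space M. d < norm (Z z)} \<le>
      emeasure M {z \<in> space M. 1 \<le> ennreal (1 / d powr p) * ennreal (norm (Z z) powr p)}"
    by (intro emeasure_mono) auto
  also have "\<dots> \<le> ennreal (1 / d powr p) * (\<integral>\<^sup>+z. ennreal (norm (Z z) powr p) * indicator (space M) z \<partial>M)"
    by (intro nn_integral_Markov_inequality) auto
  also have "(\<integral>\<^sup>+z. ennreal (norm (Z z) powr p) * indicator (space M) z \<partial>M) =
      (\<integral>\<^sup>+z. ennreal (norm (Z z) powr p) \<partial>M)"
    by (intro nn_integral_cong) auto
  also have "ennreal (1 / d powr p) * \<dots> \<le> ennreal (1 / d powr p) * ennreal C"
    by (intro mult_left_mono le) auto
  also have "\<dots> = ennreal (C / d powr p)"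
    using C by (simp add: ennreal_mult[symmetric])
  finally show ?thesis
    using C by (simp add: emeasure_eq_measure)
qed

lemma prob_measures_p_iff:
  fixes \<nu> :: "'a::euclidean_space measure"
  shows "\<nu> \<in> prob_measures_p p \<longleftrightarrow>
    prob_space \<nu> \<and> sets \<nu> = sets borel \<and> (\<integral>\<^sup>+x. ennreal (norm x powr p) \<partial>\<nu>) < \<infinity>"
  unfolding prob_measures_p_def integrable_iff_bounded
  by (auto cong: measurable_cong_sets)

definition conv :: "'a::euclidean_space measure \<Rightarrow> 'a measure \<Rightarrow> 'a measure" where
  "conv \<mu> \<nu> = distr (\<mu> \<Otimes>\<^sub>M \<nu>) borel (\<lambda>(x, y). x + y)"

lemma nn_integral_conv:
  fixes \<mu> \<nu> :: "'a::euclidean_space measure"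
  assumes "prob_space \<mu>" "prob_space \<nu>"
    and [measurable_cong]: "sets \<mu> = sets borel" "sets \<nu> = sets borel"
    and [measurable]: "F \<in> borel_measurable borel"
  shows "(\<integral>\<^sup>+z. F z \<partial>conv \<mu> \<nu>) = (\<integral>\<^sup>+x. \<integral>\<^sup>+y. F (x + y) \<partial>\<nu> \<partial>\<mu>)"
proof -
  interpret \<mu>: prob_space \<mu> by fact
  interpret \<nu>: prob_space \<nu> by fact
  show ?thesis
    unfolding conv_def by (simp add: nn_integral_distr \<nu>.nn_integral_fst[symmetric])
qed

lemma prob_measures_p_conv:
  fixes \<mu> \<nu> :: "'a::euclidean_space measure"
  assumes p: "1 \<le> p" and \<mu>: "\<mu> \<in> prob_measures_p p" and \<nu>: "\<nu> \<in> prob_measures_p p"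
  shows "conv \<mu> \<nu> \<in> prob_measures_p p"
proof -
  interpret \<mu>: prob_space \<mu> using \<mu> by (simp add: prob_measures_p_iff)
  interpret \<nu>: prob_space \<nu> using \<nu> by (simp add: prob_measures_p_iff)
  interpret pair_prob_space \<mu> \<nu> ..
  have [measurable_cong]: "sets \<mu> = sets borel" "sets \<nu> = sets borel"
    using \<mu> \<nu> by (auto simp: prob_measures_p_iff)
  let ?I = "\<lambda>\<rho>. \<integral>\<^sup>+x. ennreal (norm x powr p) \<partial>\<rho>"
  have "?I (conv \<mu> \<nu>) = (\<integral>\<^sup>+x. \<integral>\<^sup>+y. ennreal (norm (x + y) powr p) \<partial>\<nu> \<partial>\<mu>)"
    using \<mu> \<nu> by (intro nn_integral_conv) (simp_all add: prob_measures_p_iff)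
  also have "\<dots> \<le> (\<integral>\<^sup>+x. \<integral>\<^sup>+y. ennreal (2 powr p) * ennreal (norm x powr p) +
      ennreal (2 powr p) * ennreal (norm y powr p) \<partial>\<nu> \<partial>\<mu>)"
    by (intro nn_integral_mono)
       (simp add: ennreal_mult[symmetric] ennreal_plus[symmetric] distrib_left[symmetric]
          norm_add_powr_le'[OF p] del: ennreal_plus)
  also have "\<dots> = (\<integral>\<^sup>+x. ennreal (2 powr p) * ennreal (norm x powr p) + ennreal (2 powr p) * ?I \<nu> \<partial>\<mu>)"
    by (simp add: nn_integral_add nn_integral_cmult \<nu>.emeasure_space_1)
  also have "\<dots> = ennreal (2 powr p) * ?I \<mu> + ennreal (2 powr p) * ?I \<nu>"
    by (simp add: nn_integral_add nn_integral_cmult \<mu>.emeasure_space_1)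
  also have "\<dots> < \<infinity>"
    using \<mu> \<nu> by (simp add: prob_measures_p_iff ennreal_mult_less_top)
  finally have "?I (conv \<mu> \<nu>) < \<infinity>" .
  moreover have "prob_space (conv \<mu> \<nu>)"
    unfolding conv_def by (intro prob_space_distr) measurable
  ultimately show ?thesis
    by (simp add: prob_measures_p_iff conv_def)
qed

text \<open>By Fubini the shifted moment of \<nu> is finite for almost every x, hence for some x,
  and the shift is removed by the triangle inequality. This brings the moment at time 1 down to
  earlier times.\<close>

lemma prob_measures_p_conv_right:
  fixes \<mu> \<nu> :: "'a::euclidean_space measure"
  assumes p: "1 \<le> p" and \<mu>: "prob_space \<mu>" "sets \<mu> = sets borel" and \<nu>: "prob_space \<nu>" "sets \<nu> = sets borel"
    and conv: "conv \<mu> \<nu> \<in> prob_measures_p p"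
  shows "\<nu> \<in> prob_measures_p p"
proof -
  interpret \<mu>: prob_space \<mu> by fact
  interpret \<nu>: prob_space \<nu> by fact
  note [measurable_cong] = \<mu>(2) \<nu>(2)
  have "(\<integral>\<^sup>+x. \<integral>\<^sup>+y. ennreal (norm (x + y) powr p) \<partial>\<nu> \<partial>\<mu>) \<noteq> \<infinity>"
    using conv nn_integral_conv[OF \<mu>(1) \<nu>(1) \<mu>(2) \<nu>(2), of "\<lambda>x. ennreal (norm x powr p)"]
    by (simp add: prob_measures_p_iff less_top)
  then have "AE x in \<mu>. (\<integral>\<^sup>+y. ennreal (norm (x + y) powr p) \<partial>\<nu>) \<noteq> \<infinity>"
    by (rule nn_integral_noteq_infinite[rotated]) measurable
  then have "\<exists>x. (\<integral>\<^sup>+y. ennreal (norm (x + y) powr p) \<partial>\<nu>) \<noteq> \<infinity>"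
    by (rule eventually_happens'[rotated]) (simp add: \<mu>.ae_filter_bot)
  then obtain x where x: "(\<integral>\<^sup>+y. ennreal (norm (x + y) powr p) \<partial>\<nu>) < \<infinity>"
    by (auto simp: less_top)
  have "(\<integral>\<^sup>+y. ennreal (norm y powr p) \<partial>\<nu>) \<le> (\<integral>\<^sup>+y. ennreal (2 powr p) * ennreal (norm (x + y) powr p) +
      ennreal (2 powr p) * ennreal (norm x powr p) \<partial>\<nu>)"
    using norm_add_powr_le'[OF p, of "x + _" "- x"]
    by (intro nn_integral_mono)
       (simp add: ennreal_mult[symmetric] ennreal_plus[symmetric] distrib_left[symmetric] del: ennreal_plus)
  also have "\<dots> = ennreal (2 powr p) * (\<integral>\<^sup>+y. ennreal (norm (x + y) powr p) \<partial>\<nu>) +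
      ennreal (2 powr p) * ennreal (norm x powr p)"
    by (simp add: nn_integral_add nn_integral_cmult \<nu>.emeasure_space_1)
  also have "\<dots> < \<infinity>"
    using x by (simp add: ennreal_mult_less_top)
  finally show ?thesis using \<nu> by (simp add: prob_measures_p_iff)
qed

section \<open>Wasserstein balls\<close>

text \<open>A coupling \<open>(X, Y)\<close> is recorded as the joint law of \<open>X\<close> and the displacement \<open>Y - X\<close>.\<close>

definition displacements :: "real \<Rightarrow> 'a::euclidean_space measure \<Rightarrow> real \<Rightarrow> ('a \<times> 'a) measure set" where
  "displacements p \<mu> r = {\<gamma>. prob_space \<gamma> \<and> sets \<gamma> = sets borel \<and> distr \<gamma> borel fst = \<mu> \<and>
     (\<integral>\<^sup>+z. ennreal (norm (snd z) powr p) \<partial>\<gamma>) \<le> ennreal (r powr p)}"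

text \<open>The operator \<open>S_op\<close> with centre and radius no longer tied to a time, so
  that it can be studied for one measure at a time.\<close>

definition ball_sup :: "real \<Rightarrow> 'a::euclidean_space measure \<Rightarrow> real \<Rightarrow> ('a \<Rightarrow> real) \<Rightarrow> 'a \<Rightarrow> real" where
  "ball_sup p \<mu> r f x = (SUP \<nu>\<in>wasserstein_ball p \<mu> r. \<integral>y. f (x + y) \<partial>\<nu>)"

lemma displacementsD:
  assumes "\<gamma> \<in> displacements p \<mu> r"
  shows "prob_space \<gamma>" "sets \<gamma> = sets borel" "distr \<gamma> borel fst = \<mu>"
    "(\<integral>\<^sup>+z. ennreal (norm (snd z) powr p) \<partial>\<gamma>) \<le> ennreal (r powr p)"
  using assms by (auto simp: displacements_def)

lemma displacements_tail:
  fixes \<gamma> :: "('a::euclidean_space \<times> 'a) measure"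
  assumes \<gamma>: "\<gamma> \<in> displacements p \<mu> r" and p: "0 < p" and d: "0 < d"
  shows "measure \<gamma> {z \<in> space \<gamma>. d < norm (snd z)} \<le> r powr p / d powr p"
proof -
  interpret prob_space \<gamma> using displacementsD[OF \<gamma>] by simp
  note [measurable_cong] = displacementsD(2)[OF \<gamma>]
  show ?thesis
    by (rule prob_norm_gt_le) (use displacementsD[OF \<gamma>] p d in auto)
qed

lemma displacements_tail_add:
  fixes \<gamma> :: "('a::euclidean_space \<times> 'a) measure"
  assumes \<gamma>: "\<gamma> \<in> displacements p \<mu> r" and p: "0 < p" and d: "0 < d"
  shows "measure \<gamma> {z \<in> space \<gamma>. d < norm (fst z + snd z)} \<le>
    measure \<mu> {x \<in> space \<mu>. d/2 < norm x} + r powr p / (d/2) powr p"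
proof -
  interpret prob_space \<gamma> using displacementsD[OF \<gamma>] by simp
  note [measurable_cong] = displacementsD(2)[OF \<gamma>]
  have sub: "{z \<in> space \<gamma>. d < norm (fst z + snd z)} \<subseteq>
      {z \<in> space \<gamma>. d/2 < norm (fst z)} \<union> {z \<in> space \<gamma>. d/2 < norm (snd z)}"
  proof
    fix z assume "z \<in> {z \<in> space \<gamma>. d < norm (fst z + snd z)}"
    then show "z \<in> {z \<in> space \<gamma>. d/2 < norm (fst z)} \<union> {z \<in> space \<gamma>. d/2 < norm (snd z)}"
      using norm_triangle_ineq[of "fst z" "snd z"] by auto
  qed
  have "measure \<gamma> {z \<in> space \<gamma>. d < norm (fst z + snd z)} \<le>
      measure \<gamma> ({z \<in> space \<gamma>. d/2 < norm (fst z)} \<union> {z \<in> space \<gamma>. d/2 < norm (snd z)})"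
    by (rule finite_measure_mono[OF sub]) measurable
  also have "\<dots> \<le> measure \<gamma> {z \<in> space \<gamma>. d/2 < norm (fst z)} + measure \<gamma> {z \<in> space \<gamma>. d/2 < norm (snd z)}"
    by (rule measure_Un_le) measurable
  also have "measure \<gamma> {z \<in> space \<gamma>. d/2 < norm (fst z)} = measure \<mu> {x \<in> space \<mu>. d/2 < norm x}"
    unfolding displacementsD(3)[OF \<gamma>, symmetric]
    by (subst measure_distr)
       (auto intro!: arg_cong[where f = "measure \<gamma>"]
         simp: sets_eq_imp_space_eq[OF displacementsD(2)[OF \<gamma>]])
  finally show ?thesis
    using displacements_tail[OF \<gamma> p, of "d/2"] d by simp
qed

text \<open>Scaling the displacement by r / (r + e) restores the radius r and moves the endpoint by
  a vector of p-norm at most e. Where that vector is shorter than d the integrand changes by at most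
  c; elsewhere by at most 2 B, on a set of mass at most \<open>(e / d) powr p\<close> by Markov's
  inequality.\<close>

lemma displacements_shrink:
  fixes \<gamma> :: "('a::euclidean_space \<times> 'a) measure" and f :: "'a \<Rightarrow> real"
  assumes \<gamma>: "\<gamma> \<in> displacements p \<mu> (r + e)" and p: "0 < p" and r: "0 \<le> r" and e: "0 < e"
    and f: "f \<in> borel_measurable borel" and B: "0 \<le> B" "\<And>x. \<bar>f x\<bar> \<le> B"
    and d: "0 < d" and c: "0 \<le> c" "\<And>a x. norm a \<le> d \<Longrightarrow> \<bar>f (a + x) - f x\<bar> \<le> c"
  obtains \<gamma>' where "\<gamma>' \<in> displacements p \<mu> r"
    "(\<integral>z. f (x + fst z + snd z) \<partial>\<gamma>) \<le> (\<integral>z. f (x + fst z + snd z) \<partial>\<gamma>') + (c + 2 * B * (e / d) powr p)"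
proof -
  interpret prob_space \<gamma> using displacementsD[OF \<gamma>] by simp
  note [measurable_cong] = displacementsD(2)[OF \<gamma>]
  note [measurable] = f
  \<comment> \<open>For r = 0 this is q = 0, which removes the displacement altogether.\<close>
  define q where "q = r / (r + e)"
  have q: "0 \<le> q" "1 - q = e / (r + e)" "q * (r + e) = r"
    using r e by (auto simp: q_def field_simps)
  have q1: "0 \<le> 1 - q"
    unfolding q(2) using r e by simp
  define \<phi> where "\<phi> = (\<lambda>z::'a \<times> 'a. (fst z, q *\<^sub>R snd z))"
  have [measurable]: "\<phi> \<in> \<gamma> \<rightarrow>\<^sub>M borel"
    unfolding \<phi>_def by measurable
  let ?N = "\<integral>\<^sup>+z. ennreal (norm (snd z) powr p) \<partial>\<gamma>"
  have "(\<integral>\<^sup>+z. ennreal (norm (snd z) powr p) \<partial>distr \<gamma> borel \<phi>) =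
      (\<integral>\<^sup>+z. ennreal (q powr p) * ennreal (norm (snd z) powr p) \<partial>\<gamma>)"
    using q by (subst nn_integral_distr) (auto simp: \<phi>_def powr_mult ennreal_mult)
  also have "\<dots> = ennreal (q powr p) * ?N"
    by (rule nn_integral_cmult) measurable
  also have "\<dots> \<le> ennreal (q powr p) * ennreal ((r + e) powr p)"
    by (intro mult_left_mono displacementsD(4)[OF \<gamma>]) auto
  also have "\<dots> = ennreal (r powr p)"
    using q r e by (simp add: ennreal_mult[symmetric] powr_mult[symmetric])
  finally have "distr \<gamma> borel \<phi> \<in> displacements p \<mu> r"
    using displacementsD(3)[OF \<gamma>]
    by (auto simp: displacements_def prob_space_distr distr_distr comp_def \<phi>_def)
  moreover have "(\<integral>z. f (x + fst z + snd z) \<partial>\<gamma>) \<le>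
      (\<integral>z. f (x + fst z + snd z) \<partial>distr \<gamma> borel \<phi>) + (c + 2 * B * (e / d) powr p)"
  proof -
    let ?g = "\<lambda>z. f (x + fst z + snd z) - f (x + fst z + q *\<^sub>R snd z)"
    have int: "integrable \<gamma> (\<lambda>z. f (x + fst z + snd z))" "integrable \<gamma> (\<lambda>z. f (x + fst z + q *\<^sub>R snd z))"
      by (intro integrable_const_bound[where B = B]; use B in simp)+
    have "\<bar>\<integral>z. ?g z \<partial>\<gamma>\<bar> \<le> c + 2 * B * prob {z \<in> space \<gamma>. d < norm ((1 - q) *\<^sub>R snd z)}"
    proof (rule abs_integral_le_small)
      fix z :: "'a \<times> 'a"
      show "\<bar>?g z\<bar> \<le> 2 * B"
        using B(2)[of "x + fst z + snd z"] B(2)[of "x + fst z + q *\<^sub>R snd z"] by linarith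
      assume "norm ((1 - q) *\<^sub>R snd z) \<le> d"
      moreover have "x + fst z + snd z = (1 - q) *\<^sub>R snd z + (x + fst z + q *\<^sub>R snd z)"
        by (simp add: algebra_simps)
      ultimately show "\<bar>?g z\<bar> \<le> c"
        using c(2)[of "(1 - q) *\<^sub>R snd z" "x + fst z + q *\<^sub>R snd z"] by metis
    qed (use B c in auto)
    also have "prob {z \<in> space \<gamma>. d < norm ((1 - q) *\<^sub>R snd z)} \<le> e powr p / d powr p"
    proof (rule prob_norm_gt_le)
      have "(\<integral>\<^sup>+z. ennreal (norm ((1 - q) *\<^sub>R snd z) powr p) \<partial>\<gamma>) = ennreal ((1 - q) powr p) * ?N"
        by (subst nn_integral_cmult[symmetric]) (auto simp: abs_of_nonneg[OF q1] powr_mult ennreal_mult q1)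
      also have "\<dots> \<le> ennreal ((1 - q) powr p) * ennreal ((r + e) powr p)"
        by (intro mult_left_mono displacementsD(4)[OF \<gamma>]) auto
      also have "\<dots> = ennreal (e powr p)"
        unfolding q(2) using r e by (simp add: ennreal_mult[symmetric] powr_mult[symmetric])
      finally show "(\<integral>\<^sup>+z. ennreal (norm ((1 - q) *\<^sub>R snd z) powr p) \<partial>\<gamma>) \<le> ennreal (e powr p)" .
    qed (use d p in auto)
    finally have "\<bar>\<integral>z. ?g z \<partial>\<gamma>\<bar> \<le> c + 2 * B * (e / d) powr p"
      using B e d by (simp add: powr_divide mult_left_mono)
    moreover have "(\<integral>z. f (x + fst z + snd z) \<partial>distr \<gamma> borel \<phi>) = (\<integral>z. f (x + fst z + q *\<^sub>R snd z) \<partial>\<gamma>)"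
      by (subst integral_distr) (auto simp: \<phi>_def)
    ultimately show ?thesis
      using Bochner_Integration.integral_diff[OF int] by linarith
  qed
  ultimately show thesis by (rule that)
qed

section \<open>From couplings to displacements and back\<close>

lemma couplings_nonempty:
  fixes \<mu> \<nu> :: "'a::euclidean_space measure"
  assumes "prob_space \<mu>" "prob_space \<nu>" and [measurable_cong]: "sets \<mu> = sets borel" "sets \<nu> = sets borel"
  shows "couplings \<mu> \<nu> \<noteq> {}"
proof -
  interpret \<mu>: prob_space \<mu> by fact
  interpret \<nu>: prob_space \<nu> by fact
  interpret pair_prob_space \<mu> \<nu> ..
  have "distr (\<mu> \<Otimes>\<^sub>M \<nu>) borel fst = \<mu>"
  proof (rule measure_eqI)
    fix A assume "A \<in> sets (distr (\<mu> \<Otimes>\<^sub>M \<nu>) borel fst)"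
    then have [measurable]: "A \<in> sets borel" by simp
    have "emeasure (distr (\<mu> \<Otimes>\<^sub>M \<nu>) borel fst) A = emeasure (\<mu> \<Otimes>\<^sub>M \<nu>) (A \<times> space \<nu>)"
      using assms sets_eq_imp_space_eq[OF assms(3)]
      by (subst emeasure_distr) (auto intro!: arg_cong[where f = "emeasure (\<mu> \<Otimes>\<^sub>M \<nu>)"] simp: space_pair_measure)
    also have "\<dots> = emeasure \<mu> A"
      by (subst \<nu>.emeasure_pair_measure_Times) (simp_all add: assms(3) \<nu>.emeasure_space_1)
    finally show "emeasure (distr (\<mu> \<Otimes>\<^sub>M \<nu>) borel fst) A = emeasure \<mu> A" .
  qed (simp add: assms)
  moreover have "distr (\<mu> \<Otimes>\<^sub>M \<nu>) borel snd = \<nu>"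
  proof (rule measure_eqI)
    fix A assume "A \<in> sets (distr (\<mu> \<Otimes>\<^sub>M \<nu>) borel snd)"
    then have [measurable]: "A \<in> sets borel" by simp
    have "emeasure (distr (\<mu> \<Otimes>\<^sub>M \<nu>) borel snd) A = emeasure (\<mu> \<Otimes>\<^sub>M \<nu>) (space \<mu> \<times> A)"
      using assms sets_eq_imp_space_eq[OF assms(4)]
      by (subst emeasure_distr) (auto intro!: arg_cong[where f = "emeasure (\<mu> \<Otimes>\<^sub>M \<nu>)"] simp: space_pair_measure)
    also have "\<dots> = emeasure \<nu> A"
      by (subst \<nu>.emeasure_pair_measure_Times) (simp_all add: assms(4) \<mu>.emeasure_space_1)
    finally show "emeasure (distr (\<mu> \<Otimes>\<^sub>M \<nu>) borel snd) A = emeasure \<nu> A" .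
  qed (simp add: assms)
  moreover have "sets (\<mu> \<Otimes>\<^sub>M \<nu>) = sets borel"
    using sets_pair_measure_cong[OF assms(3,4)] by (simp only: borel_prod)
  ultimately have "\<mu> \<Otimes>\<^sub>M \<nu> \<in> couplings \<mu> \<nu>"
    by (simp add: couplings_def prob_space_axioms)
  then show ?thesis by blast
qed

lemma integrable_norm_diff_powr:
  fixes \<gamma> :: "('a::euclidean_space \<times> 'a) measure"
  assumes p: "1 \<le> p" and \<gamma>: "\<gamma> \<in> couplings \<mu> \<nu>"
    and \<mu>: "\<mu> \<in> prob_measures_p p" and \<nu>: "\<nu> \<in> prob_measures_p p"
  shows "integrable \<gamma> (\<lambda>z. norm (snd z - fst z) powr p)"
proof -
  have [measurable_cong]: "sets \<gamma> = sets borel" and d: "distr \<gamma> borel fst = \<mu>" "distr \<gamma> borel snd = \<nu>"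
    using \<gamma> by (auto simp: couplings_def)
  have "integrable (distr \<gamma> borel fst) (\<lambda>x. norm x powr p)" "integrable (distr \<gamma> borel snd) (\<lambda>x. norm x powr p)"
    using \<mu> \<nu> unfolding d by (auto simp: prob_measures_p_def)
  then have "integrable \<gamma> (\<lambda>z. norm (fst z) powr p)" "integrable \<gamma> (\<lambda>z. norm (snd z) powr p)"
    by (simp_all add: integrable_distr_eq)
  then have "integrable \<gamma> (\<lambda>z. 2 powr p * (norm (snd z) powr p + norm (fst z) powr p))"
    by (intro integrable_mult_right Bochner_Integration.integrable_add)
  then show ?thesis
  proof (rule Bochner_Integration.integrable_bound)
    show "AE z in \<gamma>. norm (norm (snd z - fst z) powr p) \<le>
        norm (2 powr p * (norm (snd z) powr p + norm (fst z) powr p))"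
    proof (rule AE_I2)
      fix z :: "'a \<times> 'a"
      show "norm (norm (snd z - fst z) powr p) \<le> norm (2 powr p * (norm (snd z) powr p + norm (fst z) powr p))"
        using norm_add_powr_le'[OF p, of "snd z" "- fst z"] by simp
    qed
  qed measurable
qed

text \<open>The infimum defining the distance yields only couplings of cost below r + c;
  \<open>displacements_shrink\<close> brings such a coupling back to radius r. The error e pays for
  this.\<close>

lemma wasserstein_ball_displacement:
  fixes f :: "'a::euclidean_space \<Rightarrow> real"
  assumes p: "1 < p" and r: "0 \<le> r" and \<mu>: "\<mu> \<in> prob_measures_p p"
    and \<nu>: "\<nu> \<in> wasserstein_ball p \<mu> r" and f: "f \<in> C0" and e: "0 < e"
  obtains \<gamma> where "\<gamma> \<in> displacements p \<mu> r" "(\<integral>y. f (x + y) \<partial>\<nu>) \<le> (\<integral>z. f (x + fst z + snd z) \<partial>\<gamma>) + e"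
proof -
  obtain B where B: "0 \<le> B" "\<And>x. \<bar>f x\<bar> \<le> B"
    using C0_bounded[OF f] by blast
  obtain d where d: "0 < d" "\<And>a x. norm a \<le> d \<Longrightarrow> \<bar>f (a + x) - f x\<bar> \<le> e/2"
    using C0_uniformly_continuous[OF f, of "e/2"] e by auto
  \<comment> \<open>Chosen so that 2 B (c/d)^p \<le> e/2; the 1 added to B avoids division by
    zero.\<close>
  define c where "c = d * (e / (4 * (B + 1))) powr (1/p)"
  have c: "0 < c"
    using B e d by (auto simp: c_def)
  have "(c / d) powr p = e / (4 * (B + 1))"
    using d(1) p B e by (simp add: c_def powr_powr)
  moreover have "2 * B * (e / (4 * (B + 1))) \<le> e/2"
    using B e by (simp add: field_simps)
  ultimately have c2: "e/2 + 2 * B * (c / d) powr p \<le> e"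
    by simp
  have \<nu>p: "\<nu> \<in> prob_measures_p p" and w: "wasserstein p \<mu> \<nu> < r + c"
    using \<nu> c by (auto simp: wasserstein_ball_def)
  \<comment> \<open>An infimum below r + c produces a coupling only if the set of couplings is
    nonempty; the infimum of the empty set would be an unrelated default value.\<close>
  have "couplings \<mu> \<nu> \<noteq> {}"
    using \<mu> \<nu>p by (intro couplings_nonempty) (auto simp: prob_measures_p_iff)
  with w obtain \<gamma> where \<gamma>: "\<gamma> \<in> couplings \<mu> \<nu>"
      and "(\<integral>z. norm (snd z - fst z) powr p \<partial>\<gamma>) powr (1 / p) < r + c"
    unfolding wasserstein_def by (auto dest: cInf_lessD[rotated])
  then have "((\<integral>z. norm (snd z - fst z) powr p \<partial>\<gamma>) powr (1 / p)) powr p \<le> (r + c) powr p"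
    using p by (intro powr_mono2) auto
  then have I: "(\<integral>z. norm (snd z - fst z) powr p \<partial>\<gamma>) \<le> (r + c) powr p"
    using p by (simp add: powr_powr integral_nonneg_AE)
  have [measurable_cong]: "sets \<gamma> = sets borel" and marg: "distr \<gamma> borel fst = \<mu>" "distr \<gamma> borel snd = \<nu>"
    and "prob_space \<gamma>"
    using \<gamma> by (auto simp: couplings_def)
  interpret prob_space \<gamma> by fact
  have [measurable]: "f \<in> borel_measurable borel" using f by (rule C0_measurable)
  define \<phi> where "\<phi> = (\<lambda>z::'a \<times> 'a. (fst z, snd z - fst z))"
  have [measurable]: "\<phi> \<in> \<gamma> \<rightarrow>\<^sub>M borel"
    unfolding \<phi>_def by measurable
  have "(\<integral>\<^sup>+z. ennreal (norm (snd z) powr p) \<partial>distr \<gamma> borel \<phi>) =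
      (\<integral>\<^sup>+z. ennreal (norm (snd z - fst z) powr p) \<partial>\<gamma>)"
    by (subst nn_integral_distr) (auto simp: \<phi>_def)
  also have "\<dots> = ennreal (\<integral>z. norm (snd z - fst z) powr p \<partial>\<gamma>)"
    using p by (intro nn_integral_eq_integral integrable_norm_diff_powr[OF _ \<gamma> \<mu> \<nu>p]) auto
  also have "\<dots> \<le> ennreal ((r + c) powr p)"
    using I by (rule ennreal_leI)
  finally have "distr \<gamma> borel \<phi> \<in> displacements p \<mu> (r + c)"
    using marg by (auto simp: displacements_def prob_space_distr distr_distr comp_def \<phi>_def)
  then obtain \<gamma>' where \<gamma>': "\<gamma>' \<in> displacements p \<mu> r"
    "(\<integral>z. f (x + fst z + snd z) \<partial>distr \<gamma> borel \<phi>) \<le>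
      (\<integral>z. f (x + fst z + snd z) \<partial>\<gamma>') + (e/2 + 2 * B * (c / d) powr p)"
    by (rule displacements_shrink[where f = f and B = B and d = d and c = "e/2" and x = x])
       (use p r c B d e in auto)
  have "(\<integral>z. f (x + fst z + snd z) \<partial>distr \<gamma> borel \<phi>) = (\<integral>z. f (x + snd z) \<partial>\<gamma>)"
    by (subst integral_distr) (auto simp: \<phi>_def)
  also have "\<dots> = (\<integral>y. f (x + y) \<partial>distr \<gamma> borel snd)"
    by (subst integral_distr) auto
  finally have "(\<integral>z. f (x + fst z + snd z) \<partial>distr \<gamma> borel \<phi>) = (\<integral>y. f (x + y) \<partial>\<nu>)"
    by (simp add: marg)
  with \<gamma>' c2 show thesis by (intro that[of \<gamma>']) auto
qed

text \<open>This direction is exact: the pair (X, X + Z) is itself a coupling of cost at most r, and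
  the infimum can only be smaller.\<close>

lemma displacement_wasserstein_ball:
  fixes \<gamma> :: "('a::euclidean_space \<times> 'a) measure"
  assumes p: "1 < p" and r: "0 \<le> r" and \<mu>: "\<mu> \<in> prob_measures_p p" and \<gamma>: "\<gamma> \<in> displacements p \<mu> r"
  shows "distr \<gamma> borel (\<lambda>z. fst z + snd z) \<in> wasserstein_ball p \<mu> r"
proof -
  interpret prob_space \<gamma> using displacementsD[OF \<gamma>] by simp
  note [measurable_cong] = displacementsD(2)[OF \<gamma>]
  let ?\<nu> = "distr \<gamma> borel (\<lambda>z. fst z + snd z)"
  have "integrable (distr \<gamma> borel fst) (\<lambda>x. norm x powr p)"
    using \<mu> unfolding displacementsD(3)[OF \<gamma>] by (simp add: prob_measures_p_def)
  then have i1: "integrable \<gamma> (\<lambda>z. norm (fst z) powr p)"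
    by (simp add: integrable_distr_eq)
  have i2: "integrable \<gamma> (\<lambda>z. norm (snd z) powr p)"
    unfolding integrable_iff_bounded using displacementsD(4)[OF \<gamma>] le_less_trans[OF _ ennreal_less_top] by auto
  have "integrable \<gamma> (\<lambda>z. 2 powr p * (norm (fst z) powr p + norm (snd z) powr p))"
    by (intro integrable_mult_right Bochner_Integration.integrable_add i1 i2)
  then have "integrable \<gamma> (\<lambda>z. norm (fst z + snd z) powr p)"
  proof (rule Bochner_Integration.integrable_bound)
    show "AE z in \<gamma>. norm (norm (fst z + snd z) powr p) \<le>
        norm (2 powr p * (norm (fst z) powr p + norm (snd z) powr p))"
    proof (rule AE_I2)
      fix z :: "'a \<times> 'a"
      show "norm (norm (fst z + snd z) powr p) \<le> norm (2 powr p * (norm (fst z) powr p + norm (snd z) powr p))"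
        using norm_add_powr_le'[of p "fst z" "snd z"] p by simp
    qed
  qed measurable
  then have \<nu>: "?\<nu> \<in> prob_measures_p p"
    by (auto simp: prob_measures_p_def integrable_distr_eq prob_space_distr)
  define \<phi> where "\<phi> = (\<lambda>z::'a \<times> 'a. (fst z, fst z + snd z))"
  have [measurable]: "\<phi> \<in> \<gamma> \<rightarrow>\<^sub>M borel"
    unfolding \<phi>_def by measurable
  have c: "distr \<gamma> borel \<phi> \<in> couplings \<mu> ?\<nu>"
    using displacementsD(3)[OF \<gamma>]
    by (auto simp: couplings_def prob_space_distr distr_distr comp_def \<phi>_def)
  have "ennreal (\<integral>z. norm (snd z) powr p \<partial>\<gamma>) \<le> ennreal (r powr p)"
    using displacementsD(4)[OF \<gamma>] nn_integral_eq_integral[OF i2] by simp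
  then have "(\<integral>z. norm (snd z) powr p \<partial>\<gamma>) \<le> r powr p"
    by simp
  then have "(\<integral>z. norm (snd z) powr p \<partial>\<gamma>) powr (1/p) \<le> (r powr p) powr (1/p)"
    using p by (intro powr_mono2) (auto intro: integral_nonneg_AE)
  then have le: "(\<integral>z. norm (snd z - fst z) powr p \<partial>distr \<gamma> borel \<phi>) powr (1/p) \<le> r"
    using p r by (subst integral_distr) (auto simp: \<phi>_def powr_powr)
  have "wasserstein p \<mu> ?\<nu> \<le> (\<integral>z. norm (snd z - fst z) powr p \<partial>distr \<gamma> borel \<phi>) powr (1/p)"
    unfolding wasserstein_def by (intro cINF_lower c bdd_belowI2[where m = 0]) auto
  then show ?thesis
    using le \<nu> by (auto simp: wasserstein_ball_def)
qed

lemma displacements_zero: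
  fixes \<mu> :: "'a::euclidean_space measure"
  assumes "prob_space \<mu>" "sets \<mu> = sets borel" 
  shows "distr \<mu> borel (\<lambda>x. (x, 0)) \<in> displacements p \<mu> r"
proof -
  interpret prob_space \<mu> by fact
  note [measurable_cong] = assms(2)
  have "distr \<mu> borel (\<lambda>x. x) = \<mu>"
    by (rule distr_id2) (simp add: assms)
  then show ?thesis
    by (auto simp: displacements_def prob_space_distr distr_distr comp_def nn_integral_distr)
qed

lemma wasserstein_ball_nonempty:
  assumes "1 < p" "0 \<le> r" "\<mu> \<in> prob_measures_p p"
  shows "wasserstein_ball p \<mu> r \<noteq> {}"
  using displacement_wasserstein_ball[OF assms displacements_zero] assms(3)
  by (auto simp: prob_measures_p_iff)

section \<open>The supremum over one ball as a sublinear operator\<close>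

lemma C0_integrable:
  assumes "prob_space \<nu>" and [measurable_cong]: "sets \<nu> = sets borel" and f: "f \<in> C0"
  shows "integrable \<nu> (\<lambda>y. f (x + y))"
proof -
  interpret prob_space \<nu> by fact
  obtain B where "\<And>x. \<bar>f x\<bar> \<le> B"
    using C0_bounded[OF f] by blast
  moreover have [measurable]: "f \<in> borel_measurable borel" using f by (rule C0_measurable)
  ultimately show ?thesis
    by (intro integrable_const_bound[where B = B]) auto
qed

lemma C0_integral_le:
  assumes \<nu>: "prob_space \<nu>" "sets \<nu> = sets borel" and f: "f \<in> C0" and "\<And>y. f y \<le> c"
  shows "(\<integral>y. f (x + y) \<partial>\<nu>) \<le> c"
proof -
  interpret prob_space \<nu> by fact
  show ?thesis
    using integral_mono[OF C0_integrable[OF \<nu> f, of x], of "\<lambda>_. c"] assms(4) by (simp add: prob_space)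
qed

text \<open>Centre and radius are parameters so that the balls around \<mu>, \<nu> and their
  convolution can be used side by side.\<close>

locale moment_ball =
  fixes p :: real and \<mu> :: "'a::euclidean_space measure" and r :: real
  assumes p: "1 < p" and r: "0 \<le> r" and \<mu>: "\<mu> \<in> prob_measures_p p"
begin

lemma ballD:
  assumes "\<nu> \<in> wasserstein_ball p \<mu> r"
  shows "prob_space \<nu>" "sets \<nu> = sets borel"
  using assms by (auto simp: wasserstein_ball_def prob_measures_p_def)

lemma ball_nonempty: "wasserstein_ball p \<mu> r \<noteq> {}"
  by (rule wasserstein_ball_nonempty[OF p r \<mu>])

lemma bdd_above_ball:
  assumes f: "f \<in> C0"
  shows "bdd_above ((\<lambda>\<nu>. \<integral>y. f (x + y) \<partial>\<nu>) ` wasserstein_ball p \<mu> r)"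
proof -
  obtain B where B: "\<And>x. \<bar>f x\<bar> \<le> B"
    using C0_bounded[OF f] by blast
  have "f y \<le> B" for y using B[of y] by simp
  then have "(\<integral>y. f (x + y) \<partial>\<nu>) \<le> B" if "\<nu> \<in> wasserstein_ball p \<mu> r" for \<nu>
    by (rule C0_integral_le[OF ballD[OF that] f])
  then show ?thesis by (auto intro!: bdd_aboveI2)
qed

lemma integral_le_ball_sup:
  "f \<in> C0 \<Longrightarrow> \<nu> \<in> wasserstein_ball p \<mu> r \<Longrightarrow> (\<integral>y. f (x + y) \<partial>\<nu>) \<le> ball_sup p \<mu> r f x"
  unfolding ball_sup_def by (intro cSUP_upper bdd_above_ball)

lemma ball_sup_le:
  "(\<And>\<nu>. \<nu> \<in> wasserstein_ball p \<mu> r \<Longrightarrow> (\<integral>y. f (x + y) \<partial>\<nu>) \<le> c) \<Longrightarrow> ball_sup p \<mu> r f x \<le> c"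
  unfolding ball_sup_def by (intro cSUP_least ball_nonempty)

lemma displacement_le_ball_sup:
  assumes f: "f \<in> C0" and \<gamma>: "\<gamma> \<in> displacements p \<mu> r"
  shows "(\<integral>z. f (x + fst z + snd z) \<partial>\<gamma>) \<le> ball_sup p \<mu> r f x"
proof -
  note [measurable_cong] = displacementsD(2)[OF \<gamma>]
  have [measurable]: "f \<in> borel_measurable borel" using f by (rule C0_measurable)
  have "(\<integral>y. f (x + y) \<partial>distr \<gamma> borel (\<lambda>z. fst z + snd z)) = (\<integral>z. f (x + fst z + snd z) \<partial>\<gamma>)"
    by (subst integral_distr) (auto simp: add.assoc)
  then show ?thesis
    using integral_le_ball_sup[OF f displacement_wasserstein_ball[OF p r \<mu> \<gamma>], of x] by simp
qed

lemma displacement_near_ball_sup: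
  assumes f: "f \<in> C0" and e: "0 < e"
  obtains \<gamma> where "\<gamma> \<in> displacements p \<mu> r" "ball_sup p \<mu> r f x \<le> (\<integral>z. f (x + fst z + snd z) \<partial>\<gamma>) + e"
proof -
  have "ball_sup p \<mu> r f x - e/2 < ball_sup p \<mu> r f x" using e by simp
  then obtain \<nu> where \<nu>: "\<nu> \<in> wasserstein_ball p \<mu> r" "ball_sup p \<mu> r f x - e/2 < (\<integral>y. f (x + y) \<partial>\<nu>)"
    unfolding ball_sup_def by (subst (asm) less_cSUP_iff[OF ball_nonempty bdd_above_ball[OF f]]) blast
  obtain \<gamma> where "\<gamma> \<in> displacements p \<mu> r" "(\<integral>y. f (x + y) \<partial>\<nu>) \<le> (\<integral>z. f (x + fst z + snd z) \<partial>\<gamma>) + e/2"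
    using wasserstein_ball_displacement[OF p r \<mu> \<nu>(1) f, of "e/2" x] e by auto
  with \<nu>(2) show thesis by (intro that[of \<gamma>]) auto
qed

text \<open>The law of the displacement has mass at most \<open>r\<^sup>p / (d/2)\<^sup>p\<close> outside the ball of radius \<open>d/2\<close>,
  so both the behaviour at infinity and small-time continuity reduce to the tails of \<open>\<mu>\<close>.\<close>

lemma ball_sup_local_bound:
  assumes f: "f \<in> C0" and d: "0 < d" and B: "0 \<le> B" "\<And>y. \<bar>f y - a\<bar> \<le> B"
    and c: "0 \<le> c" "\<And>y. norm y \<le> d \<Longrightarrow> \<bar>f (x + y) - a\<bar> \<le> c"
  shows "\<bar>ball_sup p \<mu> r f x - a\<bar> \<le>
    c + B * (measure \<mu> {x \<in> space \<mu>. d/2 < norm x} + r powr p / (d/2) powr p)" (is "_ \<le> ?R")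
proof -
  have [measurable]: "f \<in> borel_measurable borel" using f by (rule C0_measurable)
  have le: "\<bar>(\<integral>z. f (x + fst z + snd z) \<partial>\<gamma>) - a\<bar> \<le> ?R" if \<gamma>: "\<gamma> \<in> displacements p \<mu> r" for \<gamma>
  proof -
    interpret prob_space \<gamma> using displacementsD[OF \<gamma>] by simp
    note [measurable_cong] = displacementsD(2)[OF \<gamma>]
    have int: "integrable \<gamma> (\<lambda>z. f (x + fst z + snd z))"
    proof -
      obtain B where "\<And>x. \<bar>f x\<bar> \<le> B"
        using C0_bounded[OF f] by blast
      then show ?thesis by (intro integrable_const_bound[where B = B]) auto
    qed
    have "\<bar>\<integral>z. f (x + fst z + snd z) - a \<partial>\<gamma>\<bar> \<le>
        c + B * prob {z \<in> space \<gamma>. d < norm (fst z + snd z)}"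
      by (rule abs_integral_le_small) (use B c in \<open>auto simp: add.assoc\<close>)
    also have "\<dots> \<le> ?R"
      using p d B by (intro add_left_mono mult_left_mono displacements_tail_add \<gamma>) auto
    finally show ?thesis
      using int by (simp add: prob_space)
  qed
  have "\<bar>ball_sup p \<mu> r f x - a\<bar> \<le> ?R + e" if e: "0 < e" for e
  proof -
    obtain \<gamma> where \<gamma>: "\<gamma> \<in> displacements p \<mu> r"
        "ball_sup p \<mu> r f x \<le> (\<integral>z. f (x + fst z + snd z) \<partial>\<gamma>) + e"
      by (rule displacement_near_ball_sup[OF f e])
    show ?thesis
      using \<gamma>(2) le[OF \<gamma>(1)] displacement_le_ball_sup[OF f \<gamma>(1), of x] e by linarith
  qed
  then show ?thesis by (rule field_le_epsilon)
qed

text \<open>Two base points are allowed so that the same function seen from x and from a + x can be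
  compared; this gives the modulus of continuity.\<close>

lemma ball_sup_contraction:
  assumes f: "f \<in> C0" and g: "g \<in> C0" and e: "\<And>y. f (x + y) \<le> g (x' + y) + e"
  shows "ball_sup p \<mu> r f x \<le> ball_sup p \<mu> r g x' + e"
proof (rule ball_sup_le)
  fix \<nu> assume \<nu>: "\<nu> \<in> wasserstein_ball p \<mu> r"
  interpret prob_space \<nu> using ballD[OF \<nu>] by simp
  have "(\<integral>y. f (x + y) \<partial>\<nu>) \<le> (\<integral>y. g (x' + y) + e \<partial>\<nu>)"
    using C0_integrable[OF ballD[OF \<nu>] f] C0_integrable[OF ballD[OF \<nu>] g]
    by (intro integral_mono e) auto
  also have "\<dots> = (\<integral>y. g (x' + y) \<partial>\<nu>) + e"
    using C0_integrable[OF ballD[OF \<nu>] g, of x'] by (simp add: prob_space)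
  also have "\<dots> \<le> ball_sup p \<mu> r g x' + e"
    using integral_le_ball_sup[OF g \<nu>, of x'] by simp
  finally show "(\<integral>y. f (x + y) \<partial>\<nu>) \<le> ball_sup p \<mu> r g x' + e" .
qed

lemma ball_sup_modulus:
  assumes f: "f \<in> C0" and e: "\<And>y. \<bar>f (a + y) - f y\<bar> \<le> e"
  shows "\<bar>ball_sup p \<mu> r f (a + x) - ball_sup p \<mu> r f x\<bar> \<le> e"
proof -
  have "f (a + x + y) \<le> f (x + y) + e" "f (x + y) \<le> f (a + x + y) + e" for y
    using e[of "x + y"] by (auto simp: add.assoc)
  then show ?thesis
    using ball_sup_contraction[OF f f, of "a + x" x e] ball_sup_contraction[OF f f, of x "a + x" e]
    by (simp add: abs_le_iff)
qed

lemma prob_norm_gt_small: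
  assumes e: "0 < e"
  obtains d where "0 < d" "measure \<mu> {x \<in> space \<mu>. d < norm x} \<le> e"
proof -
  interpret prob_space \<mu> using \<mu> by (simp add: prob_measures_p_iff)
  have [measurable_cong]: "sets \<mu> = sets borel" using \<mu> by (simp add: prob_measures_p_iff)
  have "(\<integral>\<^sup>+x. ennreal (norm x powr p) \<partial>\<mu>) < \<infinity>"
    using \<mu> by (simp add: prob_measures_p_iff)
  then obtain C where C: "0 \<le> C" "(\<integral>\<^sup>+x. ennreal (norm x powr p) \<partial>\<mu>) = ennreal C"
    by (metis ennreal_cases infinity_ennreal_def less_irrefl)
  \<comment> \<open>Markov's inequality bounds the tail by C / d^p; adding 1 to C keeps d positive
    when C = 0.\<close>
  define d where "d = ((C + 1) / e) powr (1/p)"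
  have d: "0 < d" "d powr p = (C + 1) / e"
    using C e p by (auto simp: d_def powr_powr)
  have "prob {x \<in> space \<mu>. d < norm x} \<le> C / d powr p"
    by (rule prob_norm_gt_le) (use C d p in auto)
  also have "\<dots> \<le> e"
    using C e unfolding d by (simp add: field_simps)
  finally show thesis using d(1) that by blast
qed

text \<open>From a base point far out, the region where f is large is reached only by a jump longer
  than d, and such jumps have small probability uniformly over the ball.\<close>

lemma ball_sup_C0:
  assumes f: "f \<in> C0"
  shows "ball_sup p \<mu> r f \<in> C0"
  unfolding C0_iff
proof safe
  show "continuous_on UNIV (ball_sup p \<mu> r f)"
  proof (rule continuous_of_modulus)
    fix e :: real assume "0 < e"
    then obtain d where d: "0 < d" "\<And>a x. norm a \<le> d \<Longrightarrow> \<bar>f (a + x) - f x\<bar> \<le> e"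
      using C0_uniformly_continuous[OF f] by blast
    then show "\<exists>d>0. \<forall>a x. norm a \<le> d \<longrightarrow> \<bar>ball_sup p \<mu> r f (a + x) - ball_sup p \<mu> r f x\<bar> \<le> e"
      using ball_sup_modulus[OF f] by blast
  qed
next
  fix e :: real assume e: "0 < e"
  interpret prob_space \<mu> using \<mu> by (simp add: prob_measures_p_iff)
  have [measurable_cong]: "sets \<mu> = sets borel" using \<mu> by (simp add: prob_measures_p_iff)
  obtain B where B: "0 \<le> B" "\<And>x. \<bar>f x\<bar> \<le> B"
    using C0_bounded[OF f] by blast
  obtain R where R: "0 < R" "\<And>x. R \<le> norm x \<Longrightarrow> \<bar>f x\<bar> < e/4"
    using C0_small_outside[OF f, of "e/4"] e by auto
  \<comment> \<open>Two tails of size \<eta>, weighted by the bound B, cost at most e/4. Another e/4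
    comes from the smallness of f outside radius R.\<close>
  define \<eta> where "\<eta> = e / (8 * (B + 1))"
  have \<eta>: "0 < \<eta>" and B\<eta>: "2 * (B * \<eta>) \<le> e/4"
    using B e by (auto simp: \<eta>_def field_simps)
  obtain d1 where d1: "0 < d1" "prob {x \<in> space \<mu>. d1 < norm x} \<le> \<eta>"
    using prob_norm_gt_small[OF \<eta>] by blast
  define d2 where "d2 = ((r powr p + 1) / \<eta>) powr (1/p)"
  have "0 < r powr p + 1"
    by (rule add_nonneg_pos) auto
  then have d2: "0 < d2" "d2 powr p = (r powr p + 1) / \<eta>"
    using \<eta> p by (auto simp: d2_def powr_powr)
  \<comment> \<open>The local bound measures both tails beyond d/2, hence the factor 2.\<close>
  define d where "d = 2 * max d1 d2"
  have d: "0 < d" using d1 by (auto simp: d_def)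
  have tail: "prob {x \<in> space \<mu>. d/2 < norm x} \<le> \<eta>"
    by (rule order_trans[OF finite_measure_mono d1(2)]) (auto simp: d_def)
  have "r powr p / (d/2) powr p \<le> r powr p / d2 powr p"
    using d2(1) p by (intro divide_left_mono powr_mono2 mult_pos_pos) (auto simp: d_def max_def)
  also have "\<dots> \<le> \<eta>"
    using \<eta> \<open>0 < r powr p + 1\<close> unfolding d2 by (simp add: pos_divide_le_eq algebra_simps)
  finally have "B * (prob {x \<in> space \<mu>. d/2 < norm x} + r powr p / (d/2) powr p) \<le> B * (\<eta> + \<eta>)"
    using tail B by (intro mult_left_mono add_mono) auto
  then have small: "B * (prob {x \<in> space \<mu>. d/2 < norm x} + r powr p / (d/2) powr p) \<le> e/4"
    by (rule order_trans) (use B\<eta> in \<open>simp add: algebra_simps\<close>)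
  have "\<bar>ball_sup p \<mu> r f x\<bar> < e" if x: "R + d \<le> norm x" for x
  proof -
    have "\<bar>f (x + y)\<bar> \<le> e/4" if "norm y \<le> d" for y
      using that x norm_triangle_ineq[of "x + y" "- y"] by (intro less_imp_le[OF R(2)]) auto
    then have "\<bar>ball_sup p \<mu> r f x - 0\<bar> \<le> e/4 + B * (prob {x \<in> space \<mu>. d/2 < norm x} + r powr p / (d/2) powr p)"
      using e B by (intro ball_sup_local_bound f d) auto
    then show ?thesis using small e unfolding diff_0_right by linarith
  qed
  then show "\<exists>R. \<forall>x. R \<le> norm x \<longrightarrow> \<bar>ball_sup p \<mu> r f x\<bar> < e" by blast
qed

lemma ball_sup_sublin_op: "sublin_op (ball_sup p \<mu> r)"
  unfolding sublin_op_def
proof (intro conjI ballI allI impI)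
  fix f g :: "'a \<Rightarrow> real" and x assume f: "f \<in> C0" and g: "g \<in> C0"
  show "ball_sup p \<mu> r (\<lambda>y. f y + g y) x \<le> ball_sup p \<mu> r f x + ball_sup p \<mu> r g x"
  proof (rule ball_sup_le)
    fix \<nu> assume \<nu>: "\<nu> \<in> wasserstein_ball p \<mu> r"
    have "(\<integral>y. f (x + y) + g (x + y) \<partial>\<nu>) = (\<integral>y. f (x + y) \<partial>\<nu>) + (\<integral>y. g (x + y) \<partial>\<nu>)"
      by (intro Bochner_Integration.integral_add C0_integrable[OF ballD[OF \<nu>]] f g)
    then show "(\<integral>y. f (x + y) + g (x + y) \<partial>\<nu>) \<le> ball_sup p \<mu> r f x + ball_sup p \<mu> r g x"
      using integral_le_ball_sup[OF f \<nu>, of x] integral_le_ball_sup[OF g \<nu>, of x] by simp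
  qed
next
  fix f :: "'a \<Rightarrow> real" and c :: real assume f: "f \<in> C0" and c: "0 < c"
  have le: "ball_sup p \<mu> r (\<lambda>y. c * f y) x \<le> c * ball_sup p \<mu> r f x" if "f \<in> C0" "0 < c" for f c x
  proof (rule ball_sup_le)
    fix \<nu> assume \<nu>: "\<nu> \<in> wasserstein_ball p \<mu> r"
    show "(\<integral>y. c * f (x + y) \<partial>\<nu>) \<le> c * ball_sup p \<mu> r f x"
      using integral_le_ball_sup[OF that(1) \<nu>, of x] that(2) by simp
  qed
  show "ball_sup p \<mu> r (\<lambda>y. c * f y) = (\<lambda>x. c * ball_sup p \<mu> r f x)"
  proof
    fix x
    \<comment> \<open>The reverse inequality is the same inequality for the function c f and the
      factor 1/c.\<close>
    have "c * ball_sup p \<mu> r f x \<le> ball_sup p \<mu> r (\<lambda>y. c * f y) x"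
      using le[OF C0_cmult[OF f, of c], of "1 / c" x] c by (simp add: field_simps)
    then show "ball_sup p \<mu> r (\<lambda>y. c * f y) x = c * ball_sup p \<mu> r f x"
      using le[OF f c, of x] by simp
  qed
next
  fix f :: "'a \<Rightarrow> real" and c x assume f: "f \<in> C0" and c: "\<forall>y. f y \<le> c"
  show "ball_sup p \<mu> r f x \<le> c"
    by (rule ball_sup_le) (use C0_integral_le[OF ballD f] c in blast)
next
  fix f :: "'a \<Rightarrow> real" and a assume "f \<in> C0"
  show "ball_sup p \<mu> r (\<lambda>y. f (a + y)) = (\<lambda>x. ball_sup p \<mu> r f (a + x))"
    by (simp add: ball_sup_def[abs_def] add.assoc)
qed (rule ball_sup_C0)

end

text \<open>Minkowski's inequality; the degenerate radii \<open>r = 0\<close> and \<open>s = 0\<close>, where the convexity estimate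
  divides by zero, are reached from positive radii by continuity.\<close>

lemma nn_integral_norm_add_le:
  fixes Z :: "'b \<Rightarrow> 'a::euclidean_space" and W :: "'c \<Rightarrow> 'a" and \<kappa> :: "'b \<Rightarrow> 'c measure"
  assumes p: "1 \<le> p" and r: "0 \<le> r" and s: "0 \<le> s"
    and M: "prob_space M" and \<kappa>: "\<And>z. prob_space (\<kappa> z)"
    and [measurable]: "Z \<in> borel_measurable M" and W: "\<And>z. W \<in> borel_measurable (\<kappa> z)"
    and Zr: "(\<integral>\<^sup>+z. ennreal (norm (Z z) powr p) \<partial>M) \<le> ennreal (r powr p)"
    and Ws: "\<And>z. (\<integral>\<^sup>+w. ennreal (norm (W w) powr p) \<partial>\<kappa> z) \<le> ennreal (s powr p)"
  shows "(\<integral>\<^sup>+z. \<integral>\<^sup>+w. ennreal (norm (Z z + W w) powr p) \<partial>\<kappa> z \<partial>M) \<le> ennreal ((r + s) powr p)"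
proof -
  interpret prob_space M by fact
  let ?I = "\<integral>\<^sup>+z. \<integral>\<^sup>+w. ennreal (norm (Z z + W w) powr p) \<partial>\<kappa> z \<partial>M"
  have le: "?I \<le> ennreal ((r + s + 2 * e) powr p)" if e: "0 < e" for e
  proof -
    define a b where "a = r + e" and "b = s + e"
    have ab: "0 < a" "0 < b" "r powr p \<le> a powr p" "s powr p \<le> b powr p" "a + b = r + s + 2 * e"
      using e r s p by (auto simp: a_def b_def intro!: powr_mono2)
    \<comment> \<open>The coefficients in \<open>norm_add_powr_le\<close>, normalised so that
      inserting the bounds a and b for the two p-norms gives exactly 1.\<close>
    define u v where "u = a / (a + b) / a powr p" and "v = b / (a + b) / b powr p"
    have uv: "0 \<le> u" "0 \<le> v" "u * a powr p + v * b powr p = 1"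
      using ab(1,2) by (auto simp: u_def v_def add_divide_distrib[symmetric])
    let ?c = "ennreal ((a + b) powr p)"
    have inner: "(\<integral>\<^sup>+w. ennreal (norm (Z z + W w) powr p) \<partial>\<kappa> z) \<le>
        ?c * (ennreal u * ennreal (norm (Z z) powr p) + ennreal (v * b powr p))" for z
    proof -
      interpret \<kappa>: prob_space "\<kappa> z" by fact
      note [measurable] = W[of z]
      have "(\<integral>\<^sup>+w. ennreal (norm (Z z + W w) powr p) \<partial>\<kappa> z) \<le>
          (\<integral>\<^sup>+w. ?c * (ennreal (u * norm (Z z) powr p) + ennreal v * ennreal (norm (W w) powr p)) \<partial>\<kappa> z)"
      proof (rule nn_integral_mono)
        fix w
        have "norm (Z z + W w) powr p \<le> (a + b) powr p * (u * norm (Z z) powr p + v * norm (W w) powr p)"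
          unfolding u_def v_def by (rule norm_add_powr_le[OF p ab(1,2)])
        then show "ennreal (norm (Z z + W w) powr p) \<le>
            ?c * (ennreal (u * norm (Z z) powr p) + ennreal v * ennreal (norm (W w) powr p))"
          using uv(1,2) by (simp add: ennreal_mult[symmetric] ennreal_plus[symmetric] del: ennreal_plus)
      qed
      also have "\<dots> = ?c * (ennreal (u * norm (Z z) powr p) + ennreal v * (\<integral>\<^sup>+w. ennreal (norm (W w) powr p) \<partial>\<kappa> z))"
        by (simp add: nn_integral_cmult nn_integral_add \<kappa>.emeasure_space_1)
      also have "\<dots> \<le> ?c * (ennreal (u * norm (Z z) powr p) + ennreal v * ennreal (b powr p))"
        by (intro mult_left_mono add_left_mono order_trans[OF Ws] ennreal_leI ab) auto
      finally show ?thesis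
        using uv by (simp add: ennreal_mult)
    qed
    have "?I \<le> (\<integral>\<^sup>+z. ?c * (ennreal u * ennreal (norm (Z z) powr p) + ennreal (v * b powr p)) \<partial>M)"
      by (intro nn_integral_mono inner)
    also have "\<dots> = ?c * (ennreal u * (\<integral>\<^sup>+z. ennreal (norm (Z z) powr p) \<partial>M) + ennreal (v * b powr p))"
      by (simp add: nn_integral_cmult nn_integral_add emeasure_space_1)
    also have "\<dots> \<le> ?c * (ennreal u * ennreal (a powr p) + ennreal (v * b powr p))"
      by (intro mult_left_mono add_right_mono order_trans[OF Zr] ennreal_leI ab) auto
    also have "\<dots> = ennreal ((a + b) powr p)"
      using uv by (simp add: ennreal_mult[symmetric] ennreal_plus[symmetric] del: ennreal_plus)
    finally show ?thesis using ab by simp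
  qed
  \<comment> \<open>If r = s = 0 the base tends to 0; continuity of the power there uses p > 0 and a
    nonnegative base.\<close>
  have lim: "((\<lambda>e. ennreal ((r + s + 2 * e) powr p)) \<longlongrightarrow> ennreal ((r + s + 2 * 0) powr p)) (at_right 0)"
  proof (intro tendsto_ennrealI tendsto_powr')
    show "((\<lambda>e. r + s + 2 * e) \<longlongrightarrow> r + s + 2 * 0) (at_right 0)"
      by (intro tendsto_intros)
    have "\<forall>\<^sub>F e in at_right 0. 0 \<le> r + s + 2 * e"
      using r s by (auto simp: eventually_at_right_field intro!: exI[of _ 1])
    then show "r + s + 2 * 0 \<noteq> 0 \<or> 0 < p \<and> (\<forall>\<^sub>F e in at_right 0. 0 \<le> r + s + 2 * e)"
      using p by auto
  qed auto
  have "\<forall>\<^sub>F e in at_right 0. ?I \<le> ennreal ((r + s + 2 * e) powr p)"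
    using le by (auto simp: eventually_at_right_field intro!: exI[of _ 1])
  then have "?I \<le> ennreal ((r + s + 2 * 0) powr p)"
    by (rule tendsto_lowerbound[OF lim]) simp
  then show ?thesis by simp
qed

text \<open>The first coordinate of \<open>\<kappa> z\<close> has law \<open>\<nu>\<close> for every \<open>z\<close>, so it is independent of \<open>z\<close>; this is why the
  first marginal is a convolution.\<close>

lemma displacements_bind:
  fixes \<gamma> :: "('a::euclidean_space \<times> 'a) measure"
  assumes p: "1 \<le> p" and r: "0 \<le> r" and s: "0 \<le> s"
    and \<gamma>: "\<gamma> \<in> displacements p \<mu> r" and \<kappa>: "\<And>z. \<kappa> z \<in> displacements p \<nu> s"
    and K [measurable]: "(\<lambda>z. distr (\<kappa> z) borel ((+) z)) \<in> \<gamma> \<rightarrow>\<^sub>M prob_algebra borel"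
  shows "\<gamma> \<bind> (\<lambda>z. distr (\<kappa> z) borel ((+) z)) \<in> displacements p (conv \<mu> \<nu>) (r + s)" (is "?\<gamma> \<in> _")
proof -
  interpret prob_space \<gamma> using displacementsD[OF \<gamma>] by simp
  note [measurable_cong] = displacementsD(2)[OF \<gamma>] displacementsD(2)[OF \<kappa>]
  \<comment> \<open>Any single \<open>\<kappa> z\<close> reveals that \<nu> is a Borel probability
    measure, so an arbitrary index serves.\<close>
  have [simp]: "prob_space \<mu>" "prob_space \<nu>" "sets \<mu> = sets borel" "sets \<nu> = sets borel"
    unfolding displacementsD(3)[OF \<gamma>, symmetric] displacementsD(3)[OF \<kappa>[of undefined], symmetric]
    by (simp_all add: prob_space_distr prob_space.prob_space_distr[OF displacementsD(1)[OF \<kappa>]])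
  have space: "\<gamma> \<in> space (prob_algebra \<gamma>)"
    by (simp add: space_prob_algebra prob_space_axioms)
  have bind: "(\<integral>\<^sup>+z. F z \<partial>?\<gamma>) = (\<integral>\<^sup>+z. \<integral>\<^sup>+w. F (z + w) \<partial>\<kappa> z \<partial>\<gamma>)"
    if [measurable]: "F \<in> borel_measurable borel" for F :: "'a \<times> 'a \<Rightarrow> ennreal"
    by (subst nn_integral_bind[OF _ measurable_prob_algebraD[OF K]])
       (auto simp: nn_integral_distr intro!: nn_integral_cong)
  have sets: "sets ?\<gamma> = sets borel"
    by (rule sets_bind'[OF space K])
  interpret \<nu>: prob_space \<nu> by simp
  have sets_\<nu>: "sets \<nu> = sets borel" by simp
  note [measurable_cong] = sets sets_\<nu>
  have "distr ?\<gamma> borel fst = conv \<mu> \<nu>"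
  proof (rule measure_eqI)
    fix A assume "A \<in> sets (distr ?\<gamma> borel fst)"
    then have [measurable]: "A \<in> sets borel" by simp
    have "emeasure (distr ?\<gamma> borel fst) A = (\<integral>\<^sup>+x. indicator A x \<partial>distr ?\<gamma> borel fst)"
      by simp
    also have "\<dots> = (\<integral>\<^sup>+z. indicator A (fst z) \<partial>?\<gamma>)"
      by (rule nn_integral_distr) measurable
    also have "\<dots> = (\<integral>\<^sup>+z. \<integral>\<^sup>+w. indicator A (fst z + fst w) \<partial>\<kappa> z \<partial>\<gamma>)"
      by (subst bind) auto
    also have "\<dots> = (\<integral>\<^sup>+z. \<integral>\<^sup>+y. indicator A (fst z + y) \<partial>\<nu> \<partial>\<gamma>)"
    proof (rule nn_integral_cong)
      fix z
      have "(\<integral>\<^sup>+w. indicator A (fst z + fst w) \<partial>\<kappa> z) = (\<integral>\<^sup>+y. indicator A (fst z + y) \<partial>distr (\<kappa> z) borel fst)"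
        by (subst nn_integral_distr) auto
      then show "(\<integral>\<^sup>+w. indicator A (fst z + fst w) \<partial>\<kappa> z) = (\<integral>\<^sup>+y. indicator A (fst z + y) \<partial>\<nu>)"
        by (simp add: displacementsD(3)[OF \<kappa>])
    qed
    also have "\<dots> = (\<integral>\<^sup>+x. \<integral>\<^sup>+y. indicator A (x + y) \<partial>\<nu> \<partial>distr \<gamma> borel fst)"
      by (rule nn_integral_distr[symmetric]) measurable
    also have "\<dots> = (\<integral>\<^sup>+z. indicator A z \<partial>conv \<mu> \<nu>)"
      unfolding displacementsD(3)[OF \<gamma>] by (subst nn_integral_conv) auto
    finally show "emeasure (distr ?\<gamma> borel fst) A = emeasure (conv \<mu> \<nu>) A"
      by (simp add: conv_def)
  qed (simp add: conv_def)
  moreover have "(\<integral>\<^sup>+z. ennreal (norm (snd z) powr p) \<partial>?\<gamma>) \<le> ennreal ((r + s) powr p)"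
  proof (subst bind)
    show "(\<integral>\<^sup>+z. \<integral>\<^sup>+w. ennreal (norm (snd (z + w)) powr p) \<partial>\<kappa> z \<partial>\<gamma>) \<le> ennreal ((r + s) powr p)"
      unfolding snd_add
      by (rule nn_integral_norm_add_le[OF p r s prob_space_axioms])
         (use displacementsD[OF \<gamma>] displacementsD[OF \<kappa>] in auto)
  qed measurable
  ultimately show ?thesis
    using prob_space_bind'[OF space K] sets by (simp add: displacements_def)
qed

text \<open>A nearly optimal second stage is chosen only at the points of a countable dense set, and
  the position reached after the first stage is rounded to such a point. The rounding is harmless
  because f and the inner supremum share a modulus of continuity.\<close>

lemma ball_sup_compose_le:
  fixes \<mu> \<nu> :: "'a::euclidean_space measure"
  assumes p: "1 < p" and r: "0 \<le> r" and s: "0 \<le> s"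
    and \<mu>: "\<mu> \<in> prob_measures_p p" and \<nu>: "\<nu> \<in> prob_measures_p p" and f: "f \<in> C0"
  shows "ball_sup p \<mu> r (ball_sup p \<nu> s f) x \<le> ball_sup p (conv \<mu> \<nu>) (r + s) f x"
proof (rule field_le_epsilon)
  fix e :: real assume e: "0 < e"
  interpret \<mu>: moment_ball p \<mu> r using p r \<mu> by unfold_locales
  interpret \<nu>: moment_ball p \<nu> s using p s \<nu> by unfold_locales
  interpret conv: moment_ball p "conv \<mu> \<nu>" "r + s"
    using p r s \<mu> \<nu> by unfold_locales (auto intro: prob_measures_p_conv)
  define g where "g = ball_sup p \<nu> s f"
  have g: "g \<in> C0" unfolding g_def by (rule \<nu>.ball_sup_C0[OF f])
  have [measurable]: "f \<in> borel_measurable borel" "g \<in> borel_measurable borel"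
    using f g by (auto intro: C0_measurable)
  \<comment> \<open>The four parts of e: near-optimality of \<gamma>, rounding in g, near-optimality
    of \<kappa>, and rounding back in f. The last three make up the \<open>3 * c\<close> in
    \<open>near\<close>.\<close>
  define c where "c = e / 4"
  have c: "0 < c" using e by (simp add: c_def)
  obtain d where d: "0 < d" "\<And>a x. norm a \<le> d \<Longrightarrow> \<bar>f (a + x) - f x\<bar> \<le> c"
    using C0_uniformly_continuous[OF f c] by blast
  have dg: "\<bar>g (a + x) - g x\<bar> \<le> c" if "norm a \<le> d" for a x
    unfolding g_def by (rule \<nu>.ball_sup_modulus[OF f d(2)[OF that]])
  obtain \<gamma> where \<gamma>: "\<gamma> \<in> displacements p \<mu> r"
      "ball_sup p \<mu> r g x \<le> (\<integral>z. g (x + fst z + snd z) \<partial>\<gamma>) + c"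
    by (rule \<mu>.displacement_near_ball_sup[OF g c])
  interpret prob_space \<gamma> using displacementsD[OF \<gamma>(1)] by simp
  note [measurable_cong] = displacementsD(2)[OF \<gamma>(1)]
  obtain Q :: "'a set" where Q: "countable Q" "\<And>U. open U \<Longrightarrow> U \<noteq> {} \<Longrightarrow> \<exists>q\<in>Q. q \<in> U"
    by (erule countable_dense_setE)
  define q where "q = from_nat_into Q"
  have "Q \<noteq> {}" using Q(2)[of UNIV] by auto
  then have "\<exists>n. dist (q n) y < d" for y
    using Q(2)[of "ball y d"] d(1) from_nat_into_surj[OF Q(1)] by (force simp: q_def dist_commute)
  \<comment> \<open>Taking the least admissible index makes the rounding a measurable map into a
    discrete space.\<close>
  define i where "i y = (LEAST n. dist (q n) y < d)" for y
  have i: "dist (q (i y)) y < d" for y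
    unfolding i_def by (rule LeastI_ex) fact
  have [measurable]: "i \<in> borel \<rightarrow>\<^sub>M count_space UNIV"
    unfolding i_def by measurable
  have "\<forall>n. \<exists>\<kappa>\<in>displacements p \<nu> s. g (q n) \<le> (\<integral>w. f (q n + fst w + snd w) \<partial>\<kappa>) + c"
    unfolding g_def using \<nu>.displacement_near_ball_sup[OF f c] by metis
  then obtain \<kappa> where \<kappa>: "\<And>n. \<kappa> n \<in> displacements p \<nu> s"
      "\<And>n. g (q n) \<le> (\<integral>w. f (q n + fst w + snd w) \<partial>\<kappa> n) + c"
    by metis
  define y where "y z = x + fst z + snd z" for z :: "'a \<times> 'a"
  have [measurable]: "y \<in> borel \<rightarrow>\<^sub>M borel" unfolding y_def by measurable
  note [measurable_cong] = displacementsD(2)[OF \<kappa>(1)]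
  have near: "g (y z) \<le> (\<integral>w. f (y (z + w)) \<partial>\<kappa> (i (y z))) + 3 * c" for z
  proof -
    define k where "k = q (i (y z))"
    interpret \<kappa>: prob_space "\<kappa> (i (y z))" using displacementsD[OF \<kappa>(1)] by simp
    have k: "norm (y z - k) \<le> d" "norm (k - y z) \<le> d"
      using i[of "y z"] by (auto simp: k_def dist_norm norm_minus_commute)
    have int: "integrable (\<kappa> (i (y z))) (\<lambda>w. f (a + fst w + snd w))" for a
    proof -
      obtain B where "\<And>x. \<bar>f x\<bar> \<le> B"
        using C0_bounded[OF f] by blast
      then show ?thesis by (intro \<kappa>.integrable_const_bound[where B = B]) auto
    qed
    have "(\<integral>w. f (k + fst w + snd w) \<partial>\<kappa> (i (y z))) \<le> (\<integral>w. f (y z + fst w + snd w) + c \<partial>\<kappa> (i (y z)))"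
    proof (rule integral_mono)
      fix w
      show "f (k + fst w + snd w) \<le> f (y z + fst w + snd w) + c"
        using d(2)[OF k(2), of "y z + fst w + snd w"] by (simp add: algebra_simps abs_le_iff)
    qed (use int in auto)
    also have "\<dots> = (\<integral>w. f (y z + fst w + snd w) \<partial>\<kappa> (i (y z))) + c"
      using int by (simp add: \<kappa>.prob_space)
    also have "(\<lambda>w. f (y z + fst w + snd w)) = (\<lambda>w. f (y (z + w)))"
      by (auto simp: y_def algebra_simps)
    finally show ?thesis
      using \<kappa>(2)[of "i (y z)"] dg[OF k(1), of k] by (simp add: k_def abs_le_iff)
  qed
  define K where "K z = distr (\<kappa> (i (y z))) borel ((+) z)" for z :: "'a \<times> 'a"
  \<comment> \<open>Every family indexed by a discrete space is measurable, so the arbitrary choice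
    of \<kappa> does no harm; only the index depends on z.\<close>
  have \<kappa>_meas: "(\<lambda>z. \<kappa> (i (y z))) \<in> \<gamma> \<rightarrow>\<^sub>M prob_algebra borel"
  proof (rule measurable_compose[where N = "count_space UNIV" and g = \<kappa>])
    show "\<kappa> \<in> count_space UNIV \<rightarrow>\<^sub>M prob_algebra borel"
      using displacementsD[OF \<kappa>(1)] by (auto simp: space_prob_algebra)
  qed measurable
  have K: "K \<in> \<gamma> \<rightarrow>\<^sub>M prob_algebra borel"
    unfolding K_def[abs_def]
  proof (rule measurable_distr_prob_space2[OF \<kappa>_meas])
    show "(\<lambda>(z, w). z + w) \<in> \<gamma> \<Otimes>\<^sub>M borel \<rightarrow>\<^sub>M borel" by measurable
  qed
  have bind: "\<gamma> \<bind> K \<in> displacements p (conv \<mu> \<nu>) (r + s)"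
    unfolding K_def[abs_def]
    by (rule displacements_bind) (use p r s \<gamma> \<kappa> K in \<open>auto simp: K_def[abs_def]\<close>)
  obtain B where B: "0 \<le> B" "\<And>x. \<bar>f x\<bar> \<le> B"
    using C0_bounded[OF f] by blast
  obtain B' where B': "0 \<le> B'" "\<And>x. \<bar>g x\<bar> \<le> B'"
    using C0_bounded[OF g] by blast
  have Kint: "(\<integral>w. f (y w) \<partial>K z) = (\<integral>w. f (y (z + w)) \<partial>\<kappa> (i (y z)))" for z
    unfolding K_def by (subst integral_distr) auto
  have intK: "integrable \<gamma> (\<lambda>z. \<integral>w. f (y w) \<partial>K z)"
  proof (rule integrable_const_bound[where B = B])
    have "\<bar>\<integral>w. f (y w) \<partial>K z\<bar> \<le> B" for z
    proof -
      have "prob_space (K z)"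
        unfolding K_def using displacementsD(1)[OF \<kappa>(1)] by (rule prob_space.prob_space_distr) measurable
      then interpret K: prob_space "K z" .
      have [measurable_cong]: "sets (K z) = sets borel" by (simp add: K_def)
      have "\<bar>\<integral>w. f (y w) \<partial>K z\<bar> \<le> (\<integral>w. \<bar>f (y w)\<bar> \<partial>K z)"
        by (rule integral_abs_bound)
      also have "\<dots> \<le> B"
        using B by (intro K.integral_le_const K.integrable_const_bound[where B = B]) auto
      finally show ?thesis .
    qed
    then show "AE z in \<gamma>. norm (\<integral>w. f (y w) \<partial>K z) \<le> B" by simp
    show "(\<lambda>z. \<integral>w. f (y w) \<partial>K z) \<in> borel_measurable \<gamma>"
      by (rule measurable_compose[OF measurable_prob_algebraD[OF K] integral_measurable_subprob_algebra]) measurable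
  qed
  have "(\<integral>z. g (y z) \<partial>\<gamma>) \<le> (\<integral>z. (\<integral>w. f (y w) \<partial>K z) + 3 * c \<partial>\<gamma>)"
    by (rule integral_mono)
       (use near B' intK in \<open>auto simp: Kint intro!: integrable_const_bound[where B = B']\<close>)
  also have "\<dots> = (\<integral>z. \<integral>w. f (y w) \<partial>K z \<partial>\<gamma>) + 3 * c"
    using intK by (simp add: prob_space)
  also have "(\<integral>z. \<integral>w. f (y w) \<partial>K z \<partial>\<gamma>) = (\<integral>z. f (y z) \<partial>(\<gamma> \<bind> K))"
  proof (rule integral_bind[symmetric, where K = borel and B = B and B' = 1])
    show "AE z in \<gamma>. emeasure (K z) (space (K z)) \<le> ennreal 1"
      using K by (auto intro!: AE_I2 simp: prob_space.emeasure_space_1[OF _] 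
          dest!: measurable_space simp: space_prob_algebra prob_space.emeasure_space_1)
  qed (use B K finite_measure_axioms in \<open>auto intro: measurable_prob_algebraD\<close>)
  also have "\<dots> \<le> ball_sup p (conv \<mu> \<nu>) (r + s) f x"
    unfolding y_def by (rule conv.displacement_le_ball_sup[OF f bind])
  finally show "ball_sup p \<mu> r (ball_sup p \<nu> s f) x \<le> ball_sup p (conv \<mu> \<nu>) (r + s) f x + e"
    using \<gamma>(2) by (simp add: y_def g_def c_def)
qed

section \<open>Levy processes\<close>

locale levy =
  fixes M :: "'w measure" and X :: "real \<Rightarrow> 'w \<Rightarrow> 'a::euclidean_space"
  assumes levy: "levy_process M X"
begin

sublocale prob_space M
  using levy by (simp add: levy_process_def)

abbreviation law :: "real \<Rightarrow> 'a measure" where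
  "law t \<equiv> distr M borel (X t)"

lemma X_measurable [measurable]: "0 \<le> t \<Longrightarrow> X t \<in> borel_measurable M"
  and X_0: "AE w in M. X 0 w = 0"
  and indep_increments: "0 \<le> \<tau> 0 \<Longrightarrow> (\<And>i. i < m \<Longrightarrow> \<tau> i < \<tau> (Suc i)) \<Longrightarrow>
    indep_vars (\<lambda>_. borel) (\<lambda>i w. X (\<tau> (Suc i)) w - X (\<tau> i) w) {..<m :: nat}"
  and stationary: "0 \<le> s \<Longrightarrow> 0 \<le> t \<Longrightarrow>
    distr M borel (\<lambda>w. X (s + t) w - X s w) = distr M borel (\<lambda>w. X t w - X 0 w)"
  using levy unfolding levy_process_def by blast+

lemma prob_space_law: "0 \<le> t \<Longrightarrow> prob_space (law t)"
  by (intro prob_space_distr X_measurable)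

lemma law_increment_0: "0 \<le> t \<Longrightarrow> distr M borel (\<lambda>w. X t w - X 0 w) = law t"
  using X_0 by (intro distr_cong_AE) auto

lemma law_add:
  assumes s: "0 < s" and t: "0 < t"
  shows "law (s + t) = conv (law s) (law t)"
proof -
  \<comment> \<open>The times 0, s, s + t; their strict order is where both times must be
    positive.\<close>
  define \<tau> where "\<tau> i = (if i = 0 then 0 else if i = Suc 0 then s else s + t)" for i
  define Y where "Y i w = X (\<tau> (Suc i)) w - X (\<tau> i) w" for i w
  have Y: "Y 0 = (\<lambda>w. X s w - X 0 w)" "Y (Suc 0) = (\<lambda>w. X (s + t) w - X s w)"
    by (auto simp: Y_def \<tau>_def)
  have [measurable]: "X s \<in> borel_measurable M" "X t \<in> borel_measurable M"
      "X 0 \<in> borel_measurable M" "X (s + t) \<in> borel_measurable M"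
    using s t by auto
  have "indep_vars (\<lambda>_. borel) Y {..<2}"
    unfolding Y_def using s t by (intro indep_increments) (auto simp: \<tau>_def less_2_cases_iff)
  \<comment> \<open>Independence of a family becomes independence of a pair by grouping the indices
    into two singletons and then evaluating each one-point product.\<close>
  then have "indep_var (PiM {0} (\<lambda>_. borel)) (\<lambda>\<omega>. restrict (\<lambda>i. Y i \<omega>) {0})
      (PiM {Suc 0} (\<lambda>_. borel)) (\<lambda>\<omega>. restrict (\<lambda>i. Y i \<omega>) {Suc 0})"
    by (rule indep_var_restrict) auto
  then have "indep_var borel ((\<lambda>f. f 0) \<circ> (\<lambda>\<omega>. restrict (\<lambda>i. Y i \<omega>) {0}))
      borel ((\<lambda>f. f (Suc 0)) \<circ> (\<lambda>\<omega>. restrict (\<lambda>i. Y i \<omega>) {Suc 0}))"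
    by (rule indep_var_compose) auto
  then have "indep_var borel (Y 0) borel (Y (Suc 0))"
    by (simp add: comp_def)
  then have prod: "distr M borel (Y 0) \<Otimes>\<^sub>M distr M borel (Y (Suc 0)) =
      distr M (borel \<Otimes>\<^sub>M borel) (\<lambda>w. (Y 0 w, Y (Suc 0) w))"
    by (simp add: indep_var_distribution_eq)
  have laws: "distr M borel (Y 0) = law s" "distr M borel (Y (Suc 0)) = law t"
    using s t by (simp_all add: Y law_increment_0 stationary)
  have "conv (law s) (law t) = distr M borel (\<lambda>w. Y 0 w + Y (Suc 0) w)"
    unfolding conv_def laws[symmetric] prod by (subst distr_distr) (auto simp: comp_def Y)
  also have "\<dots> = distr M borel (\<lambda>w. X (s + t) w - X 0 w)"
    by (simp add: Y)
  also have "\<dots> = law (s + t)"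
    using s t by (simp add: law_increment_0)
  finally show ?thesis ..
qed

lemma law_small_time:
  assumes d: "0 < d" and e: "0 < e"
  obtains h where "0 < h"
    "\<And>t. 0 \<le> t \<Longrightarrow> t \<le> h \<Longrightarrow> measure (law t) {x \<in> space (law t). d < norm x} \<le> e"
proof -
  have "((\<lambda>t. prob {w \<in> space M. d < norm (X t w - X 0 w)}) \<longlongrightarrow> 0) (at 0 within {0..})"
    using levy d unfolding levy_process_def by blast
  then have "\<forall>\<^sub>F t in at 0 within {0..}. prob {w \<in> space M. d < norm (X t w - X 0 w)} < e"
    using e by (auto dest: order_tendstoD(2))
  then obtain h where h: "0 < h"
      "\<And>t. 0 \<le> t \<Longrightarrow> t \<noteq> 0 \<Longrightarrow> t < h \<Longrightarrow> prob {w \<in> space M. d < norm (X t w - X 0 w)} < e"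
    by (auto simp: eventually_at dist_real_def)
  have "measure (law t) {x \<in> space (law t). d < norm x} \<le> e" if t: "0 \<le> t" "t \<le> h/2" for t
  proof -
    have [measurable]: "X t \<in> borel_measurable M" "X 0 \<in> borel_measurable M" using t by auto
    have "measure (law t) {x \<in> space (law t). d < norm x} =
        measure (distr M borel (\<lambda>w. X t w - X 0 w)) {x \<in> space borel. d < norm x}"
      using t by (simp add: law_increment_0)
    also have "\<dots> = prob {w \<in> space M. d < norm (X t w - X 0 w)}"
      by (subst measure_distr) (auto intro!: arg_cong[where f = prob])
    \<comment> \<open>The limit concerns punctured neighbourhoods of 0, so t = 0 is separate: there
      the increment vanishes and the event is empty.\<close>
    also have "\<dots> \<le> e"
      using h(2)[of t] t h(1) d e by (cases "t = 0") auto
    finally show ?thesis .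
  qed
  with h(1) show thesis by (intro that[of "h/2"]) auto
qed

text \<open>For 0 < t < 1 the law at t is a convolution factor of the law at 1 and inherits its
  moment; later times are reached by convolving with the law at 1. At time 0 the process vanishes
  almost surely.\<close>

lemma law_moment:
  assumes p: "1 < p" and 1: "law 1 \<in> prob_measures_p p" and t: "0 \<le> t"
  shows "law t \<in> prob_measures_p p"
proof -
  have small: "law t \<in> prob_measures_p p" if t: "0 < t" "t < 1" for t
  proof (rule prob_measures_p_conv_right)
    show "conv (law (1 - t)) (law t) \<in> prob_measures_p p"
      using 1 law_add[of "1 - t" t] t by simp
  qed (use p t in \<open>auto intro: prob_space_law\<close>)
  have pos: "law t \<in> prob_measures_p p" if "0 < t" "t \<le> real n" for t n
    using that
  proof (induction n arbitrary: t)
    case (Suc n)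
    show ?case
    proof (cases "t \<le> 1")
      case True
      with small[of t] 1 Suc.prems show ?thesis by (cases "t = 1") auto
    next
      case False
      then have "law t = conv (law 1) (law (t - 1))"
        using law_add[of 1 "t - 1"] by simp
      moreover have "law (t - 1) \<in> prob_measures_p p"
        using False Suc.prems by (intro Suc.IH) auto
      ultimately show ?thesis
        using p 1 by (auto intro: prob_measures_p_conv)
    qed
  qed simp
  show ?thesis
  proof (cases "t = 0")
    case True
    have [measurable]: "X 0 \<in> borel_measurable M" by simp
    have "(\<integral>\<^sup>+x. ennreal (norm x powr p) \<partial>law 0) = (\<integral>\<^sup>+w. ennreal (norm (X 0 w) powr p) \<partial>M)"
      by (rule nn_integral_distr) measurable
    also have "\<dots> = (\<integral>\<^sup>+w. 0 \<partial>M)"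
      by (rule nn_integral_cong_AE) (use X_0 in auto)
    finally have "(\<integral>\<^sup>+x. ennreal (norm x powr p) \<partial>law 0) = 0"
      by simp
    then show ?thesis
      using True prob_space_law[of 0] by (simp add: prob_measures_p_iff)
  next
    case False
    with t show ?thesis
      using pos[of t "nat \<lceil>t\<rceil>"] by (simp add: of_nat_ceiling)
  qed
qed

end

text \<open>\<open>SUP\<close> and \<open>lim\<close> are total, so well-definedness is expressed by
  separate clauses: nonempty balls, integrals bounded above over them, and convergence of the
  iterates ensure that the suprema and limits are genuine.\<close>

theorem proposition1p1:
  fixes p \<delta> :: real
    and M :: "'w measure"
    and X :: "real \<Rightarrow> 'w \<Rightarrow> 'a::euclidean_space"
    and \<mu> :: "real \<Rightarrow> 'a measure"
  assumes "1 < p" and "0 \<le> \<delta>"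
    and "levy_process M X"
    and "\<And>t. 0 \<le> t \<Longrightarrow> \<mu> t = distr M borel (X t)"
    and "integrable (\<mu> 1) (\<lambda>x. norm x powr p)"
  shows
    "(\<forall>t\<ge>0. \<mu> t \<in> prob_measures_p p \<and> wasserstein_ball p (\<mu> t) (\<delta> * t) \<noteq> {}) \<and>
     (\<forall>t\<ge>0. \<forall>f\<in>C0.
        (\<forall>x. bdd_above ((\<lambda>\<nu>. \<integral>y. f (x + y) \<partial>\<nu>) ` wasserstein_ball p (\<mu> t) (\<delta> * t))) \<and>
        S_op p \<delta> \<mu> t f \<in> C0) \<and>
     (\<forall>n\<ge>1. \<forall>t\<ge>0. \<forall>f\<in>C0. S_dyadic p \<delta> \<mu> n t f \<in> C0) \<and>
     (\<forall>t\<ge>0. \<forall>f\<in>C0. \<forall>x. convergent (\<lambda>n. S_dyadic p \<delta> \<mu> n t f x)) \<and>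
     (\<forall>f\<in>C0. S_lim p \<delta> \<mu> 0 f = f) \<and>
     (\<forall>t\<ge>0. \<forall>f\<in>C0. S_lim p \<delta> \<mu> t f \<in> C0) \<and>
     (\<forall>s\<ge>0. \<forall>t\<ge>0. \<forall>f\<in>C0. S_lim p \<delta> \<mu> t (S_lim p \<delta> \<mu> s f) = S_lim p \<delta> \<mu> (t + s) f) \<and>
     (\<forall>t\<ge>0. \<forall>x. sublinear_on_C0 (\<lambda>f. S_lim p \<delta> \<mu> t f x)) \<and>
     (\<forall>t\<ge>0. \<forall>x. \<forall>f\<in>C0. \<forall>g\<in>C0. (\<forall>y. f y \<le> g y) \<longrightarrow> S_lim p \<delta> \<mu> t f x \<le> S_lim p \<delta> \<mu> t g x) \<and>
     (\<forall>t\<ge>0. \<forall>x. S_lim p \<delta> \<mu> t (\<lambda>_. 0) x = 0) \<and>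
     (\<forall>t\<ge>0. \<forall>f\<in>C0. \<forall>g\<in>C0.
        sup_norm (\<lambda>x. S_lim p \<delta> \<mu> t f x - S_lim p \<delta> \<mu> t g x) \<le> sup_norm (\<lambda>x. f x - g x))"
proof -
  interpret levy M X by (rule levy.intro) fact
  note p = \<open>1 < p\<close> and \<delta> = \<open>0 \<le> \<delta>\<close> and \<mu> = assms(4)
  have "law 1 \<in> prob_measures_p p"
    using assms(5) prob_space_law[of 1] by (simp add: \<mu> prob_measures_p_def)
  then have \<mu>_p: "\<mu> t \<in> prob_measures_p p" if "0 \<le> t" for t
    using that by (simp add: \<mu> law_moment[OF p])
  have ball: "moment_ball p (\<mu> t) (\<delta> * t)" if "0 \<le> t" for t
    using that p \<delta> \<mu>_p by unfold_locales auto
  have S_op: "S_op p \<delta> \<mu> t = ball_sup p (\<mu> t) (\<delta> * t)" for t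
    by (intro ext) (simp add: S_op_def ball_sup_def)
  interpret S: subsemigroup "S_op p \<delta> \<mu>"
  proof
    fix t :: real assume "0 \<le> t"
    then show "sublin_op (S_op p \<delta> \<mu> t)"
      unfolding S_op by (rule moment_ball.ball_sup_sublin_op[OF ball])
  next
    fix s t :: real and f :: "'a \<Rightarrow> real" and x
    assume s: "0 < s" and t: "0 < t" and f: "f \<in> C0"
    have "\<mu> (t + s) = conv (\<mu> t) (\<mu> s)"
      using s t by (simp add: \<mu> law_add)
    then show "S_op p \<delta> \<mu> t (S_op p \<delta> \<mu> s f) x \<le> S_op p \<delta> \<mu> (t + s) f x"
      unfolding S_op using ball_sup_compose_le[OF p _ _ \<mu>_p \<mu>_p f, of "\<delta> * t" "\<delta> * s" t s x] s t \<delta>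
      by (simp add: distrib_left)
  next
    fix f :: "'a \<Rightarrow> real" and e :: real assume f: "f \<in> C0" and e: "0 < e"
    obtain B where B: "0 \<le> B" "\<And>x. \<bar>f x\<bar> \<le> B"
      using C0_bounded[OF f] by blast
    obtain d where d: "0 < d" "\<And>a x. norm a \<le> d \<Longrightarrow> \<bar>f (a + x) - f x\<bar> \<le> e/2"
      using C0_uniformly_continuous[OF f, of "e/2"] e by auto
    \<comment> \<open>The oscillation of f is at most 2 B and two tails of size \<eta> occur, so the
      total cost 4 B \<eta> stays below e/2.\<close>
    define \<eta> where "\<eta> = e / (8 * (B + 1))"
    have \<eta>: "0 < \<eta>" and "\<eta> * (8 * (B + 1)) = e"
      using B e by (auto simp: \<eta>_def)
    then have B\<eta>: "2 * B * (\<eta> + \<eta>) \<le> e/2"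
      by (simp add: algebra_simps)
    obtain h where h: "0 < h"
        "\<And>t. 0 \<le> t \<Longrightarrow> t \<le> h \<Longrightarrow> measure (law t) {x \<in> space (law t). d/2 < norm x} \<le> \<eta>"
      using law_small_time[of "d/2" \<eta>] d \<eta> by auto
    \<comment> \<open>For t \<le> h' the radius satisfies \<delta> t \<le> (d/2) \<eta>^(1/p), so
      the displacement tail is at most \<eta>. The 1 added to \<delta> covers \<delta> = 0.\<close>
    define h' where "h' = d/2 * \<eta> powr (1/p) / (\<delta> + 1)"
    have h': "0 < h'"
      using d \<eta> \<delta> by (simp add: h'_def)
    have "\<bar>S_op p \<delta> \<mu> t f x - f x\<bar> \<le> e" if t: "0 \<le> t" "t \<le> min h h'" for t x
    proof -
      have "\<delta> * t \<le> (\<delta> + 1) * h'"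
        using t \<delta> by (intro mult_mono) auto
      also have "\<dots> = d/2 * \<eta> powr (1/p)"
        unfolding h'_def times_divide_eq_right
        by (rule nonzero_mult_div_cancel_left) (use \<delta> in simp)
      finally have "(\<delta> * t) powr p \<le> (d/2 * \<eta> powr (1/p)) powr p"
        using t \<delta> p by (intro powr_mono2) auto
      also have "\<dots> = \<eta> * (d/2) powr p"
        using p d \<eta> by (subst powr_mult) (auto simp: powr_powr)
      finally have "(\<delta> * t) powr p / (d/2) powr p \<le> \<eta>"
        using d by (simp add: pos_divide_le_eq)
      moreover have "measure (\<mu> t) {x \<in> space (\<mu> t). d/2 < norm x} \<le> \<eta>"
        using h(2)[of t] t by (simp add: \<mu>)
      ultimately have "2 * B * (measure (\<mu> t) {x \<in> space (\<mu> t). d/2 < norm x} + (\<delta> * t) powr p / (d/2) powr p)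
          \<le> 2 * B * (\<eta> + \<eta>)"
        using B by (intro mult_left_mono add_mono) auto
      moreover have "\<bar>S_op p \<delta> \<mu> t f x - f x\<bar> \<le> e/2 +
          2 * B * (measure (\<mu> t) {x \<in> space (\<mu> t). d/2 < norm x} + (\<delta> * t) powr p / (d/2) powr p)"
        unfolding S_op
      proof (rule moment_ball.ball_sup_local_bound[OF ball[OF t(1)] f d(1)])
        show "\<bar>f y - f x\<bar> \<le> 2 * B" for y
          using B(2)[of x] B(2)[of y] by linarith
        show "\<bar>f (x + y) - f x\<bar> \<le> e/2" if "norm y \<le> d" for y
          using d(2)[OF that, of x] by (simp add: add.commute)
      qed (use B e in auto)
      ultimately show ?thesis
        using B\<eta> by linarith
    qed
    then show "\<exists>h>0. \<forall>t\<in>{0..h}. \<forall>x. \<bar>S_op p \<delta> \<mu> t f x - f x\<bar> \<le> e"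
      using h(1) h' by (intro exI[of _ "min h h'"]) auto
  qed
  have D: "S_dyadic p \<delta> \<mu> n t f = S.D n t f" for n t f
    by (simp add: S_dyadic_def S.D_def)
  have L: "S_lim p \<delta> \<mu> t f = S.L t f" for t f
    by (intro ext) (simp add: S_lim_def S.L_def D)
  have contr: "sup_norm (\<lambda>x. S.L t f x - S.L t g x) \<le> sup_norm (\<lambda>x. f x - g x)"
    if t: "0 \<le> t" and f: "f \<in> C0" and g: "g \<in> C0" for t f g
    unfolding sup_norm_def
  proof (rule cSUP_least)
    fix x
    obtain B where B: "\<And>x. \<bar>f x - g x\<bar> \<le> B"
      using C0_bounded[OF C0_diff[OF f g]] by blast
    \<comment> \<open>The supremum dominates every value because differences of \<open>C0\<close>
      functions are bounded.\<close>
    have "\<bar>f y - g y\<bar> \<le> (SUP x. \<bar>f x - g x\<bar>)" for y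
      by (rule cSUP_upper) (use B in \<open>auto intro!: bdd_aboveI2\<close>)
    then show "\<bar>S.L t f x - S.L t g x\<bar> \<le> (SUP x. \<bar>f x - g x\<bar>)"
      by (rule sublin_op_contraction[OF S.L_op[OF t] f g])
  qed simp
  note L_op = S.L_op
  show ?thesis
    unfolding D L
  proof (intro conjI allI ballI impI)
    show "wasserstein_ball p (\<mu> t) (\<delta> * t) \<noteq> {}" if "0 \<le> t" for t
      by (rule moment_ball.ball_nonempty[OF ball[OF that]])
    show "bdd_above ((\<lambda>\<nu>. \<integral>y. f (x + y) \<partial>\<nu>) ` wasserstein_ball p (\<mu> t) (\<delta> * t))"
      if "0 \<le> t" "f \<in> C0" for t f x
      by (rule moment_ball.bdd_above_ball[OF ball[OF that(1)] that(2)])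
    show "sublinear_on_C0 (\<lambda>f. S.L t f x)" if "0 \<le> t" for t x
      using sublin_op_add[OF L_op[OF that]] sublin_op_scale[OF L_op[OF that]]
      by (simp add: sublinear_on_C0_def)
    show "S.L t f x \<le> S.L t g x" if "0 \<le> t" "f \<in> C0" "g \<in> C0" "\<forall>y. f y \<le> g y" for t x f g
      using that by (intro sublin_op_mono[OF L_op]) auto
  qed (simp_all add: \<mu>_p sublin_op_C0[OF S.T_op] sublin_op_C0[OF S.D_op] sublin_op_C0[OF L_op]
      S.D_convergent S.L_0 S.L_semigroup sublin_op_zero[OF L_op] contr)
qed

end
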